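(* For any rack $X$, the category $\mathsf{RMod}_X$ of $X$-modules is equivalent to the category $\mathsf{Ab}(\mathsf{Rack}/X)$ of Abelian group objects in the slice category $\mathsf{Rack}/X$.
   Context: A rack is a set $X$ with a binary operation $(a,b)\mapsto a^b$ such that (R1) for all $a,b\in X$ there is a unique $c\in X$ with $c^b=a$; (R2) $(a^b)^c=(a^c)^{(b^c)}$ for all $a,b,c\in X$. A homomorphism of racks is a function $f$ with $f(a^b)=f(a)^{f(b)}$ for all $a,b$. $\mathsf{Rack}$ is the category of racks and rack homomorphisms, and $\mathsf{Rack}/X$ is its slice category over $X$. For a category $\mathsf{C}$, $\mathsf{Ab}(\mathsf{C})$ denotes the category of Abelian group objects in $\mathsf{C}$ and morphisms of $\mathsf{C}$ compatible with the group structures. A rack module over $X$ (an $X$-module) is a triple $\mathcal{A}=(A,\phi,\psi)$ consisting of Abelian groups $A_x$ ($x\in X$), Abelian group isomorphisms $\phi_{x,y}\colon A_x\to A_{x^y}$ and Abelian group homomorphisms $\psi_{y,x}\colon A_y\to A_{x^y}$ ($x,y\in X$), such that for all $x,y,z\in X$: $$\phi_{x^y,z}\phi_{x,y}=\phi_{x^z,y^z}\phi_{x,z},\qquad \phi_{x^y,z}\psi_{y,x}=\psi_{y^z,x^z}\phi_{y,z},$$ $$\psi_{z,x^y}(a)=\phi_{x^z,y^z}\psi_{z,x}(a)+\psi_{y^z,x^z}\psi_{z,y}(a)\quad\text{for all } a\in A_z.$$ A homomorphism of $X$-modules (an $X$-map) $f\colon(A,\phi,\psi)\to(B,\chi,\omega)$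 is a collection of Abelian group homomorphisms $f_x\colon A_x\to B_x$ ($x\in X$) such that $\chi_{x,y}f_x=f_{x^y}\phi_{x,y}$ and $\omega_{y,x}f_y=f_{x^y}\psi_{y,x}$ for all $x,y\in X$. $\mathsf{RMod}_X$ is the category of $X$-modules and $X$-maps. *)

theory Defs
  imports "HOL-Algebra.Group" "HOL-Library.FuncSet"
begin

section \<open>Categories\<close>

text \<open>
  The arrows from \<open>a\<close> to \<open>b\<close> form the set \<open>Hom C a b\<close>; hom-sets of different pairs of objects
  may overlap as sets, so composition and the action of a functor on arrows take the objects
  involved as arguments: \<open>Comp C a b c g f\<close> is the composite of
  \<open>f \<in> Hom C a b\<close> and \<open>g \<in> Hom C b c\<close>.
\<close>

record ('o, 'm) category =
  Obj :: "'o set"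
  Hom :: "'o \<Rightarrow> 'o \<Rightarrow> 'm set"
  Ident :: "'o \<Rightarrow> 'm"
  Comp :: "'o \<Rightarrow> 'o \<Rightarrow> 'o \<Rightarrow> 'm \<Rightarrow> 'm \<Rightarrow> 'm"

locale category =
  fixes C :: "('o, 'm) category"
  assumes ident_in_hom: "a \<in> Obj C \<Longrightarrow> Ident C a \<in> Hom C a a"
    and comp_in_hom:
      "\<lbrakk>a \<in> Obj C; b \<in> Obj C; c \<in> Obj C; f \<in> Hom C a b; g \<in> Hom C b c\<rbrakk>
        \<Longrightarrow> Comp C a b c g f \<in> Hom C a c"
    and comp_ident_left:
      "\<lbrakk>a \<in> Obj C; b \<in> Obj C; f \<in> Hom C a b\<rbrakk> \<Longrightarrow> Comp C a b b (Ident C b) f = f"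
    and comp_ident_right:
      "\<lbrakk>a \<in> Obj C; b \<in> Obj C; f \<in> Hom C a b\<rbrakk> \<Longrightarrow> Comp C a a b f (Ident C a) = f"
    and comp_assoc:
      "\<lbrakk>a \<in> Obj C; b \<in> Obj C; c \<in> Obj C; d \<in> Obj C;
        f \<in> Hom C a b; g \<in> Hom C b c; h \<in> Hom C c d\<rbrakk>
        \<Longrightarrow> Comp C a b d (Comp C b c d h g) f = Comp C a c d h (Comp C a b c g f)"

definition is_iso :: "('o, 'm) category \<Rightarrow> 'o \<Rightarrow> 'o \<Rightarrow> 'm \<Rightarrow> bool" where
  "is_iso C a b f \<longleftrightarrow> f \<in> Hom C a b \<and>
     (\<exists>g\<in>Hom C b a. Comp C a b a g f = Ident C a \<and> Comp C b a b f g = Ident C b)"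

record ('o, 'm, 'p, 'n) cat_functor =
  obj_map :: "'o \<Rightarrow> 'p"
  arr_map :: "'o \<Rightarrow> 'o \<Rightarrow> 'm \<Rightarrow> 'n"

definition is_functor ::
    "('o, 'm) category \<Rightarrow> ('p, 'n) category \<Rightarrow> ('o, 'm, 'p, 'n) cat_functor \<Rightarrow> bool" where
  "is_functor C D F \<longleftrightarrow>
     (\<forall>a\<in>Obj C. obj_map F a \<in> Obj D) \<and>
     (\<forall>a\<in>Obj C. \<forall>b\<in>Obj C. \<forall>f\<in>Hom C a b.
        arr_map F a b f \<in> Hom D (obj_map F a) (obj_map F b)) \<and>
     (\<forall>a\<in>Obj C. arr_map F a a (Ident C a) = Ident D (obj_map F a)) \<and>
     (\<forall>a\<in>Obj C. \<forall>b\<in>Obj C. \<forall>c\<in>Obj C. \<forall>f\<in>Hom C a b. \<forall>g\<in>Hom C b c.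
        arr_map F a c (Comp C a b c g f) =
        Comp D (obj_map F a) (obj_map F b) (obj_map F c) (arr_map F b c g) (arr_map F a b f))"

definition id_functor :: "('o, 'm, 'o, 'm) cat_functor" where
  "id_functor = \<lparr>obj_map = (\<lambda>a. a), arr_map = (\<lambda>a b f. f)\<rparr>"

definition comp_functor ::
    "('p, 'n, 'q, 'k) cat_functor \<Rightarrow> ('o, 'm, 'p, 'n) cat_functor \<Rightarrow> ('o, 'm, 'q, 'k) cat_functor" where
  "comp_functor G F =
     \<lparr>obj_map = (\<lambda>a. obj_map G (obj_map F a)),
      arr_map = (\<lambda>a b f. arr_map G (obj_map F a) (obj_map F b) (arr_map F a b f))\<rparr>"

definition is_natural_iso ::
    "('o, 'm) category \<Rightarrow> ('p, 'n) category \<Rightarrow> ('o, 'm, 'p, 'n) cat_functor \<Rightarrow>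
     ('o, 'm, 'p, 'n) cat_functor \<Rightarrow> ('o \<Rightarrow> 'n) \<Rightarrow> bool" where
  "is_natural_iso C D F G \<eta> \<longleftrightarrow>
     (\<forall>a\<in>Obj C. is_iso D (obj_map F a) (obj_map G a) (\<eta> a)) \<and>
     (\<forall>a\<in>Obj C. \<forall>b\<in>Obj C. \<forall>f\<in>Hom C a b.
        Comp D (obj_map F a) (obj_map F b) (obj_map G b) (\<eta> b) (arr_map F a b f) =
        Comp D (obj_map F a) (obj_map G a) (obj_map G b) (arr_map G a b f) (\<eta> a))"

definition equivalent_categories :: "('o, 'm) category \<Rightarrow> ('p, 'n) category \<Rightarrow> bool" where
  "equivalent_categories C D \<longleftrightarrow>
     category C \<and> category D \<and>
     (\<exists>F G \<eta> \<epsilon>. is_functor C D F \<and> is_functor D C G \<and>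
        is_natural_iso C C id_functor (comp_functor G F) \<eta> \<and>
        is_natural_iso D D (comp_functor F G) id_functor \<epsilon>)"

definition slice_category :: "('o, 'm) category \<Rightarrow> 'o \<Rightarrow> ('o \<times> 'm, 'm) category" where
  "slice_category C X =
     \<lparr>Obj = {(R, p). R \<in> Obj C \<and> p \<in> Hom C R X},
      Hom = (\<lambda>(R, p) (S, q). {f \<in> Hom C R S. Comp C R S X q f = p}),
      Ident = (\<lambda>(R, p). Ident C R),
      Comp = (\<lambda>(R, p) (S, q) (T, r). Comp C R S T)\<rparr>"


section \<open>Finite products and Abelian group objects\<close>

definition is_terminal :: "('o, 'm) category \<Rightarrow> 'o \<Rightarrow> bool" where
  "is_terminal C t \<longleftrightarrow> t \<in> Obj C \<and> (\<forall>a\<in>Obj C. \<exists>!f. f \<in> Hom C a t)"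

definition is_product :: "('o, 'm) category \<Rightarrow> 'o \<Rightarrow> 'o \<Rightarrow> 'o \<times> 'm \<times> 'm \<Rightarrow> bool" where
  "is_product C a b = (\<lambda>(p, p1, p2).
     p \<in> Obj C \<and> p1 \<in> Hom C p a \<and> p2 \<in> Hom C p b \<and>
     (\<forall>t\<in>Obj C. \<forall>f\<in>Hom C t a. \<forall>g\<in>Hom C t b.
        \<exists>!h. h \<in> Hom C t p \<and> Comp C t p a p1 h = f \<and> Comp C t p b p2 h = g))"

locale cartesian_category = category C for C :: "('o, 'm) category" +
  assumes has_terminal: "\<exists>t. is_terminal C t"
    and has_products: "\<lbrakk>a \<in> Obj C; b \<in> Obj C\<rbrakk> \<Longrightarrow> \<exists>p. is_product C a b p"

text \<open>
  The choices of terminal object and products below are only used for cartesian categories;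
  the resulting category of Abelian group objects does not depend on them up to isomorphism.
\<close>

definition terminal_obj :: "('o, 'm) category \<Rightarrow> 'o" where
  "terminal_obj C = (SOME t. is_terminal C t)"

definition to_terminal :: "('o, 'm) category \<Rightarrow> 'o \<Rightarrow> 'm" where
  "to_terminal C a = (THE f. f \<in> Hom C a (terminal_obj C))"

definition product_cone :: "('o, 'm) category \<Rightarrow> 'o \<Rightarrow> 'o \<Rightarrow> 'o \<times> 'm \<times> 'm" where
  "product_cone C a b = (SOME p. is_product C a b p)"

definition prod_obj :: "('o, 'm) category \<Rightarrow> 'o \<Rightarrow> 'o \<Rightarrow> 'o" where
  "prod_obj C a b = fst (product_cone C a b)"

definition proj1 :: "('o, 'm) category \<Rightarrow> 'o \<Rightarrow> 'o \<Rightarrow> 'm" where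
  "proj1 C a b = fst (snd (product_cone C a b))"

definition proj2 :: "('o, 'm) category \<Rightarrow> 'o \<Rightarrow> 'o \<Rightarrow> 'm" where
  "proj2 C a b = snd (snd (product_cone C a b))"

definition pairing :: "('o, 'm) category \<Rightarrow> 'o \<Rightarrow> 'o \<Rightarrow> 'o \<Rightarrow> 'm \<Rightarrow> 'm \<Rightarrow> 'm" where
  "pairing C t a b f g = (THE h. h \<in> Hom C t (prod_obj C a b) \<and>
     Comp C t (prod_obj C a b) a (proj1 C a b) h = f \<and>
     Comp C t (prod_obj C a b) b (proj2 C a b) h = g)"

record ('o, 'm) group_obj =
  gobj :: 'o
  gmul :: 'm
  gone :: 'm
  ginv :: 'm

definition is_group_object :: "('o, 'm) category \<Rightarrow> ('o, 'm) group_obj \<Rightarrow> bool" where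
  "is_group_object C G \<longleftrightarrow> cartesian_category C \<and>
     (let A = gobj G; m = gmul G; e = gone G; i = ginv G;
          T = terminal_obj C; P = prod_obj C A A; Q = prod_obj C P A;
          p1 = proj1 C A A; p2 = proj2 C A A; q1 = proj1 C P A; q2 = proj2 C P A;
          e' = Comp C A T A e (to_terminal C A)
      in A \<in> Obj C \<and> m \<in> Hom C P A \<and> e \<in> Hom C T A \<and> i \<in> Hom C A A \<and>
         Comp C Q P A m (pairing C Q A A (Comp C Q P A m q1) q2) =
         Comp C Q P A m (pairing C Q A A (Comp C Q P A p1 q1)
           (Comp C Q P A m (pairing C Q A A (Comp C Q P A p2 q1) q2))) \<and>
         Comp C A P A m (pairing C A A A e' (Ident C A)) = Ident C A \<and>
         Comp C A P A m (pairing C A A A (Ident C A) e') = Ident C A \<and>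
         Comp C A P A m (pairing C A A A i (Ident C A)) = e' \<and>
         Comp C A P A m (pairing C A A A (Ident C A) i) = e')"

definition is_ab_group_object :: "('o, 'm) category \<Rightarrow> ('o, 'm) group_obj \<Rightarrow> bool" where
  "is_ab_group_object C G \<longleftrightarrow> is_group_object C G \<and>
     (let A = gobj G; P = prod_obj C A A
      in Comp C P P A (gmul G) (pairing C P A A (proj2 C A A) (proj1 C A A)) = gmul G)"

definition is_group_object_hom ::
    "('o, 'm) category \<Rightarrow> ('o, 'm) group_obj \<Rightarrow> ('o, 'm) group_obj \<Rightarrow> 'm \<Rightarrow> bool" where
  "is_group_object_hom C G H f \<longleftrightarrow>
     (let A = gobj G; B = gobj H; T = terminal_obj C; P = prod_obj C A A; R = prod_obj C B B
      in f \<in> Hom C A B \<and>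
         Comp C P A B f (gmul G) =
         Comp C P R B (gmul H)
           (pairing C P B B (Comp C P A B f (proj1 C A A)) (Comp C P A B f (proj2 C A A))) \<and>
         Comp C T A B f (gone G) = gone H \<and>
         Comp C A A B f (ginv G) = Comp C A B B (ginv H) f)"

definition Ab :: "('o, 'm) category \<Rightarrow> (('o, 'm) group_obj, 'm) category" where
  "Ab C =
     \<lparr>Obj = {G. is_ab_group_object C G},
      Hom = (\<lambda>G H. {f. is_group_object_hom C G H f}),
      Ident = (\<lambda>G. Ident C (gobj G)),
      Comp = (\<lambda>G H K. Comp C (gobj G) (gobj H) (gobj K))\<rparr>"


section \<open>Racks\<close>

text \<open>\<open>ract X a b\<close> is $a^b$.\<close>

record 'u rack = "'u partial_object" +
  ract :: "'u \<Rightarrow> 'u \<Rightarrow> 'u"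

locale rack =
  fixes X :: "'u rack"
  assumes ract_closed: "\<lbrakk>a \<in> carrier X; b \<in> carrier X\<rbrakk> \<Longrightarrow> ract X a b \<in> carrier X"
    and ract_unique:
      "\<lbrakk>a \<in> carrier X; b \<in> carrier X\<rbrakk> \<Longrightarrow> \<exists>!c. c \<in> carrier X \<and> ract X c b = a"
    and ract_distrib:
      "\<lbrakk>a \<in> carrier X; b \<in> carrier X; c \<in> carrier X\<rbrakk>
        \<Longrightarrow> ract X (ract X a b) c = ract X (ract X a c) (ract X b c)"

definition rack_hom :: "'u rack \<Rightarrow> 'u rack \<Rightarrow> ('u \<Rightarrow> 'u) set" where
  "rack_hom R S = {f \<in> carrier R \<rightarrow>\<^sub>E carrier S.
     \<forall>a\<in>carrier R. \<forall>b\<in>carrier R. f (ract R a b) = ract S (f a) (f b)}"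

text \<open>
  The type \<open>'u\<close> is the universe of sets: the objects are the racks with carrier in \<open>'u\<close>. When
  \<open>'u\<close> is infinite it contains, up to bijection, the product of any two of its subsets, hence
  the fibre products of racks and the total spaces of families of groups indexed by a rack.
  Arrows are extensional functions, so equality of arrows is equality on the carrier.
\<close>

definition Rack :: "('u rack, 'u \<Rightarrow> 'u) category" where
  "Rack =
     \<lparr>Obj = {R. rack R},
      Hom = rack_hom,
      Ident = (\<lambda>R. \<lambda>a\<in>carrier R. a),
      Comp = (\<lambda>R S T g f. compose (carrier R) g f)\<rparr>"


section \<open>Rack modules\<close>

text \<open>
  The Abelian groups \<open>fib A x\<close> are written multiplicatively, as usual for \<^const>\<open>comm_group\<close>.
  The homomorphism \<open>psi A y x\<close> goes from \<open>fib A y\<close> to the fibre over $x^y$.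
\<close>

record 'u rmodule =
  fib :: "'u \<Rightarrow> 'u monoid"
  phi :: "'u \<Rightarrow> 'u \<Rightarrow> 'u \<Rightarrow> 'u"
  psi :: "'u \<Rightarrow> 'u \<Rightarrow> 'u \<Rightarrow> 'u"

locale rack_module = rack X for X :: "'u rack" +
  fixes A :: "'u rmodule"
  assumes fib_comm_group: "x \<in> carrier X \<Longrightarrow> comm_group (fib A x)"
    and phi_iso:
      "\<lbrakk>x \<in> carrier X; y \<in> carrier X\<rbrakk> \<Longrightarrow> phi A x y \<in> iso (fib A x) (fib A (ract X x y))"
    and psi_hom:
      "\<lbrakk>x \<in> carrier X; y \<in> carrier X\<rbrakk> \<Longrightarrow> psi A y x \<in> hom (fib A y) (fib A (ract X x y))"
    and phi_phi:
      "\<lbrakk>x \<in> carrier X; y \<in> carrier X; z \<in> carrier X; a \<in> carrier (fib A x)\<rbrakk>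
        \<Longrightarrow> phi A (ract X x y) z (phi A x y a) = phi A (ract X x z) (ract X y z) (phi A x z a)"
    and phi_psi:
      "\<lbrakk>x \<in> carrier X; y \<in> carrier X; z \<in> carrier X; a \<in> carrier (fib A y)\<rbrakk>
        \<Longrightarrow> phi A (ract X x y) z (psi A y x a) = psi A (ract X y z) (ract X x z) (phi A y z a)"
    and psi_add:
      "\<lbrakk>x \<in> carrier X; y \<in> carrier X; z \<in> carrier X; a \<in> carrier (fib A z)\<rbrakk>
        \<Longrightarrow> psi A z (ract X x y) a =
            phi A (ract X x z) (ract X y z) (psi A z x a)
              \<otimes>\<^bsub>fib A (ract X (ract X x y) z)\<^esub>
            psi A (ract X y z) (ract X x z) (psi A z y a)"

definition rmodule_hom :: "'u rack \<Rightarrow> 'u rmodule \<Rightarrow> 'u rmodule \<Rightarrow> ('u \<Rightarrow> 'u \<Rightarrow> 'u) set" where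
  "rmodule_hom X A B =
     {f \<in> (\<Pi>\<^sub>E x\<in>carrier X. hom (fib A x) (fib B x) \<inter> extensional (carrier (fib A x))).
        \<forall>x\<in>carrier X. \<forall>y\<in>carrier X.
          (\<forall>a\<in>carrier (fib A x). phi B x y (f x a) = f (ract X x y) (phi A x y a)) \<and>
          (\<forall>a\<in>carrier (fib A y). psi B y x (f y a) = f (ract X x y) (psi A y x a))}"

definition RMod :: "'u rack \<Rightarrow> ('u rmodule, 'u \<Rightarrow> 'u \<Rightarrow> 'u) category" where
  "RMod X =
     \<lparr>Obj = {A. rack_module X A},
      Hom = rmodule_hom X,
      Ident = (\<lambda>A. \<lambda>x\<in>carrier X. \<lambda>a\<in>carrier (fib A x). a),
      Comp = (\<lambda>A B D g f. \<lambda>x\<in>carrier X. compose (carrier (fib A x)) (g x) (f x))\<rparr>"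

end

theory Submission
  imports Defs
begin

text \<open>
  Let $X$ be a rack. An Abelian group object in the slice over $X$ is a rack $B$ over $X$ whose
  fibres are Abelian groups, such that addition, defined on pairs of points with the same image in
  $X$, is a rack homomorphism: $(a + b)^{c + d} = a^c + b^d$. Taking $b$ and $c$ to be zeros gives
  the decomposition
  \[ a^d = a^{0_y} + (0_x)^d \qquad (a \mbox{ over } x,\ d \mbox{ over } y) \]
  (\<open>ract_split\<close>), so the operation of $B$ is determined by the two families of maps
  $\phi_{x,y}(a) = a^{0_y}$ and $\psi_{y,x}(d) = (0_x)^d$. Self-distributivity of $B$, with zeros in
  all but one argument, says that these families satisfy the axioms of an $X$-module. Conversely, a
  module $A$ has a total space, the set of pairs $(x, a)$ with $a \in A_x$, on which
  \[ (x, a)^{(y, b)} = (x^y,\ \phi_{x,y}(a) + \psi_{y,x}(b)) \]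
  is a rack operation (\<open>rack_total\<close>) and addition in the fibres a rack homomorphism.

  The total space is the object part of a functor from modules to Abelian group objects. It is full
  and faithful, because a map of total spaces over $X$ that is additive on fibres is a family of
  group homomorphisms, and by the decomposition it respects the operation as soon as it respects
  acting by zeros and acting on zeros (\<open>total_map_full\<close>, \<open>total_map_faithful\<close>). It is essentially
  surjective, because the decomposition identifies $B$ with the total space of the module of its
  fibres (\<open>total_object_ess_surj\<close>). A functor with these three properties is an equivalence.

  Group objects are defined by diagrams in terms of arbitrary chosen products and an arbitrary chosen
  terminal object. What makes computing with them possible is that a point of the chosen product of
  $A$ and $B$ over $X$ is determined by its two coordinates, and that any two points with the same
  image in $X$ are the coordinates of such a point, since the chosen product is isomorphic to the
  fibre product of sets. Hence each diagram is equivalent to an identity between points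
  (\<open>is_ab_group_object_iff\<close>, \<open>is_group_object_hom_iff\<close>).
\<close>


section \<open>Equivalences from fully faithful, essentially surjective functors\<close>

lemma (in category) comp_cancel_inverse:
  assumes "a \<in> Obj C" "b \<in> Obj C" "c \<in> Obj C" "f \<in> Hom C a b"
    and "g \<in> Hom C b c" "h \<in> Hom C c b" "Comp C b c b h g = Ident C b"
  shows "Comp C a c b h (Comp C a b c g f) = f"
  using assms comp_assoc[of a b c b f g h] comp_ident_left[of a b f] by simp

text \<open>
  A choice of an object \<open>G d\<close> with an isomorphism \<open>F (G d) \<rightarrow> d\<close> for each \<open>d\<close> gives the inverse
  functor on objects. On arrows it is forced, as \<open>F\<close> is bijective on hom-sets, and each equation
  between arrows that functoriality and naturality require may be checked after applying \<open>F\<close>.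
\<close>
theorem equivalent_categories_if_fully_faithful_ess_surj:
  fixes C :: "('o, 'm) category" and D :: "('p, 'n) category"
    and F :: "('o, 'm, 'p, 'n) cat_functor"
  assumes C: "category C" and D: "category D" and F: "is_functor C D F"
    and faithful: "\<And>a b f g. \<lbrakk>a \<in> Obj C; b \<in> Obj C; f \<in> Hom C a b; g \<in> Hom C a b;
      arr_map F a b f = arr_map F a b g\<rbrakk> \<Longrightarrow> f = g"
    and full: "\<And>a b h. \<lbrakk>a \<in> Obj C; b \<in> Obj C; h \<in> Hom D (obj_map F a) (obj_map F b)\<rbrakk>
      \<Longrightarrow> \<exists>f\<in>Hom C a b. arr_map F a b f = h"
    and ess_surj: "\<And>d. d \<in> Obj D \<Longrightarrow> \<exists>c\<in>Obj C. \<exists>e. is_iso D (obj_map F c) d e"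
  shows "equivalent_categories C D"
proof -
  interpret C: category C by (rule C)
  interpret D: category D by (rule D)
  let ?F = "obj_map F" and ?Fa = "arr_map F"
  have F_obj [simp]: "\<And>a. a \<in> Obj C \<Longrightarrow> ?F a \<in> Obj D"
    and F_arr [simp]: "\<And>a b f. \<lbrakk>a \<in> Obj C; b \<in> Obj C; f \<in> Hom C a b\<rbrakk>
      \<Longrightarrow> ?Fa a b f \<in> Hom D (?F a) (?F b)"
    and F_id [simp]: "\<And>a. a \<in> Obj C \<Longrightarrow> ?Fa a a (Ident C a) = Ident D (?F a)"
    and F_comp: "\<And>a b c f g. \<lbrakk>a \<in> Obj C; b \<in> Obj C; c \<in> Obj C; f \<in> Hom C a b; g \<in> Hom C b c\<rbrakk>
      \<Longrightarrow> ?Fa a c (Comp C a b c g f) = Comp D (?F a) (?F b) (?F c) (?Fa b c g) (?Fa a b f)"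
    using F by (auto simp: is_functor_def)
  define lift where "lift a b h = (SOME f. f \<in> Hom C a b \<and> ?Fa a b f = h)" for a b h
  have lift: "lift a b h \<in> Hom C a b" "?Fa a b (lift a b h) = h"
    if "a \<in> Obj C" "b \<in> Obj C" "h \<in> Hom D (?F a) (?F b)" for a b h
    using someI_ex[of "\<lambda>f. f \<in> Hom C a b \<and> ?Fa a b f = h"] full[OF that]
    unfolding lift_def by auto
  have "\<forall>d\<in>Obj D. \<exists>c e i. c \<in> Obj C \<and> e \<in> Hom D (?F c) d \<and> i \<in> Hom D d (?F c) \<and>
      Comp D (?F c) d (?F c) i e = Ident D (?F c) \<and> Comp D d (?F c) d e i = Ident D d"
    using ess_surj by (fastforce simp: is_iso_def)
  then obtain G e i where
    "\<forall>d\<in>Obj D. G d \<in> Obj C \<and> e d \<in> Hom D (?F (G d)) d \<and> i d \<in> Hom D d (?F (G d)) \<and>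
      Comp D (?F (G d)) d (?F (G d)) (i d) (e d) = Ident D (?F (G d)) \<and>
      Comp D d (?F (G d)) d (e d) (i d) = Ident D d"
    by metis
  then have G [simp]: "\<And>d. d \<in> Obj D \<Longrightarrow> G d \<in> Obj C"
    and e [simp]: "\<And>d. d \<in> Obj D \<Longrightarrow> e d \<in> Hom D (?F (G d)) d"
    and i [simp]: "\<And>d. d \<in> Obj D \<Longrightarrow> i d \<in> Hom D d (?F (G d))"
    and ie [simp]: "\<And>d. d \<in> Obj D \<Longrightarrow> Comp D (?F (G d)) d (?F (G d)) (i d) (e d) = Ident D (?F (G d))"
    and ei [simp]: "\<And>d. d \<in> Obj D \<Longrightarrow> Comp D d (?F (G d)) d (e d) (i d) = Ident D d"
    by auto
  \<comment> \<open>The image of \<open>h\<close> under the inverse functor is the lift of its conjugate by the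
    chosen isomorphisms.\<close>
  define conj where "conj d d' h =
    Comp D (?F (G d)) d (?F (G d')) (Comp D d d' (?F (G d')) (i d') h) (e d)" for d d' h
  define G' where "G' = \<lparr>obj_map = G, arr_map = (\<lambda>d d' h. lift (G d) (G d') (conj d d' h))\<rparr>"
  have conj [simp]: "conj d d' h \<in> Hom D (?F (G d)) (?F (G d'))"
    if "d \<in> Obj D" "d' \<in> Obj D" "h \<in> Hom D d d'" for d d' h
    using that unfolding conj_def by (intro D.comp_in_hom) auto
  have conj_id: "conj d d (Ident D d) = Ident D (?F (G d))" if "d \<in> Obj D" for d
    using that unfolding conj_def by (simp add: D.comp_ident_right)
  have e_conj: "Comp D (?F (G d)) (?F (G d')) d' (e d') (conj d d' h)
      = Comp D (?F (G d)) d d' h (e d)"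
    if "d \<in> Obj D" "d' \<in> Obj D" "h \<in> Hom D d d'" for d d' h
  proof -
    have "conj d d' h = Comp D (?F (G d)) d' (?F (G d')) (i d') (Comp D (?F (G d)) d d' h (e d))"
      unfolding conj_def using that by (intro D.comp_assoc) auto
    then show ?thesis
      using that by (simp add: D.comp_cancel_inverse D.comp_in_hom)
  qed
  have mono_e: "f = g" if "d \<in> Obj D" "a \<in> Obj D" "f \<in> Hom D a (?F (G d))" "g \<in> Hom D a (?F (G d))"
    "Comp D a (?F (G d)) d (e d) f = Comp D a (?F (G d)) d (e d) g" for a d f g
    using D.comp_cancel_inverse[OF that(2) F_obj[OF G[OF that(1)]] that(1,3) e i ie]
      D.comp_cancel_inverse[OF that(2) F_obj[OF G[OF that(1)]] that(1,4) e i ie] that(1,5) by metis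
  have conj_comp: "conj d d'' (Comp D d d' d'' k h)
      = Comp D (?F (G d)) (?F (G d')) (?F (G d'')) (conj d' d'' k) (conj d d' h)"
    if "d \<in> Obj D" "d' \<in> Obj D" "d'' \<in> Obj D" "h \<in> Hom D d d'" "k \<in> Hom D d' d''" for d d' d'' h k
  proof (rule mono_e[of d'' "?F (G d)"])
    let ?a = "?F (G d)" and ?b = "?F (G d')" and ?c = "?F (G d'')"
    have "Comp D ?a ?c d'' (e d'') (Comp D ?a ?b ?c (conj d' d'' k) (conj d d' h))
        = Comp D ?a ?b d'' (Comp D ?b ?c d'' (e d'') (conj d' d'' k)) (conj d d' h)"
      using that by (intro D.comp_assoc[symmetric]) auto
    also have "\<dots> = Comp D ?a ?b d'' (Comp D ?b d' d'' k (e d')) (conj d d' h)"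
      using that by (simp add: e_conj)
    also have "\<dots> = Comp D ?a d' d'' k (Comp D ?a ?b d' (e d') (conj d d' h))"
      using that by (intro D.comp_assoc) auto
    also have "\<dots> = Comp D ?a d' d'' k (Comp D ?a d d' h (e d))"
      using that by (simp add: e_conj)
    also have "\<dots> = Comp D ?a d d'' (Comp D d d' d'' k h) (e d)"
      using that by (intro D.comp_assoc[symmetric]) auto
    finally show "Comp D ?a ?c d'' (e d'') (conj d d'' (Comp D d d' d'' k h)) =
      Comp D ?a ?c d'' (e d'') (Comp D ?a ?b ?c (conj d' d'' k) (conj d d' h))"
      using that by (simp add: e_conj D.comp_in_hom)
  qed (use that in \<open>auto intro!: D.comp_in_hom conj\<close>)
  have G'_functor: "is_functor D C G'"
    unfolding is_functor_def G'_def
  proof (intro conjI ballI; simp)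
    fix d d' h assume A: "d \<in> Obj D" "d' \<in> Obj D" "h \<in> Hom D d d'"
    then show "lift (G d) (G d') (conj d d' h) \<in> Hom C (G d) (G d')" by (simp add: lift)
  next
    fix d assume d: "d \<in> Obj D"
    then show "lift (G d) (G d) (conj d d (Ident D d)) = Ident C (G d)"
      by (intro faithful[of "G d" "G d"]) (simp_all add: lift conj_id C.ident_in_hom D.ident_in_hom)
  next
    fix d d' d'' h k
    assume A: "d \<in> Obj D" "d' \<in> Obj D" "d'' \<in> Obj D" "h \<in> Hom D d d'" "k \<in> Hom D d' d''"
    then have hk: "Comp D d d' d'' k h \<in> Hom D d d''" by (simp add: D.comp_in_hom)
    show "lift (G d) (G d'') (conj d d'' (Comp D d d' d'' k h)) =
      Comp C (G d) (G d') (G d'') (lift (G d') (G d'') (conj d' d'' k)) (lift (G d) (G d') (conj d d' h))"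
      using A hk
      by (intro faithful[of "G d" "G d''"])
        (simp_all add: lift conj_comp C.comp_in_hom D.comp_in_hom F_comp)
  qed
  have \<epsilon>: "is_natural_iso D D (comp_functor F G') id_functor e"
    unfolding is_natural_iso_def comp_functor_def id_functor_def G'_def
    by (auto simp: lift e_conj is_iso_def intro: i ie ei)
  \<comment> \<open>The unit at \<open>c\<close> is the lift of the inverse of the counit at \<open>F c\<close>.\<close>
  define \<eta> where "\<eta> c = lift c (G (?F c)) (i (?F c))" for c
  have \<eta>_hom [simp]: "\<eta> c \<in> Hom C c (G (?F c))" and F_\<eta> [simp]: "?Fa c (G (?F c)) (\<eta> c) = i (?F c)"
    if "c \<in> Obj C" for c
    using that by (simp_all add: \<eta>_def lift)
  have \<eta>_iso: "is_iso C c (G (?F c)) (\<eta> c)" if c: "c \<in> Obj C" for c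
  proof -
    define \<theta> where "\<theta> = lift (G (?F c)) c (e (?F c))"
    have \<theta>: "\<theta> \<in> Hom C (G (?F c)) c" "?Fa (G (?F c)) c \<theta> = e (?F c)"
      using c by (simp_all add: \<theta>_def lift)
    have "Comp C c (G (?F c)) c \<theta> (\<eta> c) = Ident C c"
      using c \<theta> by (intro faithful[of c c]) (simp_all add: C.comp_in_hom C.ident_in_hom F_comp)
    moreover have "Comp C (G (?F c)) c (G (?F c)) (\<eta> c) \<theta> = Ident C (G (?F c))"
      using c \<theta> by (intro faithful[of "G (?F c)" "G (?F c)"])
        (simp_all add: C.comp_in_hom C.ident_in_hom F_comp)
    ultimately show ?thesis using c \<theta> by (auto simp: is_iso_def)
  qed
  have \<eta>_nat: "Comp C c c' (G (?F c')) (\<eta> c') f =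
      Comp C c (G (?F c)) (G (?F c')) (lift (G (?F c)) (G (?F c')) (conj (?F c) (?F c') (?Fa c c' f))) (\<eta> c)"
    if c: "c \<in> Obj C" "c' \<in> Obj C" "f \<in> Hom C c c'" for c c' f
  proof (rule faithful[of c "G (?F c')"])
    let ?a = "?F c" and ?b = "?F c'" and ?h = "?Fa c c' f"
    let ?A = "?F (G ?a)" and ?B = "?F (G ?b)"
    have ab: "?a \<in> Obj D" "?b \<in> Obj D" "?h \<in> Hom D ?a ?b" using c by simp_all
    then have "Comp D ?a ?A ?B (conj ?a ?b ?h) (i ?a)
        = Comp D ?a ?a ?B (Comp D ?a ?b ?B (i ?b) ?h) (Comp D ?a ?A ?a (e ?a) (i ?a))"
      unfolding conj_def by (intro D.comp_assoc) (auto intro: D.comp_in_hom)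
    also have "\<dots> = Comp D ?a ?b ?B (i ?b) ?h"
      using ab by (simp add: D.comp_ident_right D.comp_in_hom)
    finally show "?Fa c (G ?b) (Comp C c c' (G ?b) (\<eta> c') f) = ?Fa c (G ?b)
      (Comp C c (G ?a) (G ?b) (lift (G ?a) (G ?b) (conj ?a ?b ?h)) (\<eta> c))"
      using c ab by (simp add: F_comp lift)
  qed (use c in \<open>auto intro!: C.comp_in_hom lift\<close>)
  have \<eta>: "is_natural_iso C C id_functor (comp_functor G' F) \<eta>"
    unfolding is_natural_iso_def comp_functor_def id_functor_def G'_def
    using \<eta>_iso \<eta>_nat by simp
  show ?thesis
    unfolding equivalent_categories_def using C D F G'_functor \<eta> \<epsilon> by blast
qed

section \<open>Racks over a fixed rack\<close>

lemma rack_homI: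
  assumes "f \<in> extensional (carrier R)"
    and "\<And>a. a \<in> carrier R \<Longrightarrow> f a \<in> carrier S"
    and "\<And>a b. \<lbrakk>a \<in> carrier R; b \<in> carrier R\<rbrakk> \<Longrightarrow> f (ract R a b) = ract S (f a) (f b)"
  shows "f \<in> rack_hom R S"
  using assms by (auto simp: rack_hom_def PiE_def)

lemma rack_homD:
  assumes "f \<in> rack_hom R S"
  shows "f \<in> extensional (carrier R)"
    and "a \<in> carrier R \<Longrightarrow> f a \<in> carrier S"
    and "\<lbrakk>a \<in> carrier R; b \<in> carrier R\<rbrakk> \<Longrightarrow> f (ract R a b) = ract S (f a) (f b)"
  using assms by (auto simp: rack_hom_def PiE_def)

lemma (in rack) ract_right_cancel:
  "\<lbrakk>a \<in> carrier X; b \<in> carrier X; c \<in> carrier X; ract X a c = ract X b c\<rbrakk> \<Longrightarrow> a = b"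
  using ract_unique[of "ract X a c" c] ract_closed by metis

lemma compose_eq_iff:
  "compose S g f = compose S k h \<longleftrightarrow> (\<forall>x\<in>S. g (f x) = k (h x))"
  by (auto simp: compose_def restrict_def fun_eq_iff)

lemma compose_eq_restrict_iff:
  "compose S g f = restrict h S \<longleftrightarrow> (\<forall>x\<in>S. g (f x) = h x)"
  by (auto simp: compose_def restrict_def fun_eq_iff)

lemma compose_eq_extensional_iff:
  "h \<in> extensional S \<Longrightarrow> compose S g f = h \<longleftrightarrow> (\<forall>x\<in>S. g (f x) = h x)"
  by (auto simp: compose_def restrict_def fun_eq_iff extensional_def)

text \<open>
  The categories below only contain objects whose points lie in the universe \<open>'u\<close>, so a set of
  pairs becomes an object by encoding pairs as elements of the universe.
\<close>

definition encode :: "'u \<times> 'u \<Rightarrow> 'u" where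
  "encode = (SOME c. inj c)"

definition decode :: "'u \<Rightarrow> 'u \<times> 'u" where
  "decode = inv_into UNIV encode"

text \<open>
  An infinite set is in bijection with its square.
\<close>
lemma decode_encode:
  assumes "infinite (UNIV :: 'u set)"
  shows "decode (encode z :: 'u) = z"
proof -
  have "(card_of (UNIV \<times> UNIV :: ('u \<times> 'u) set), card_of (UNIV :: 'u set)) \<in> ordIso"
    using card_of_Times_same_infinite[OF assms] .
  then have "\<exists>c :: 'u \<times> 'u \<Rightarrow> 'u. inj c"
    using card_of_ordIso[of "UNIV :: ('u \<times> 'u) set" "UNIV :: 'u set"]
    by (auto simp: bij_betw_def)
  then have "inj (encode :: 'u \<times> 'u \<Rightarrow> 'u)"
    unfolding encode_def by (rule someI_ex)
  then show ?thesis
    by (simp add: decode_def)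
qed

definition encoded_rack ::
    "('u \<times> 'u) set \<Rightarrow> ('u \<times> 'u \<Rightarrow> 'u \<times> 'u \<Rightarrow> 'u \<times> 'u) \<Rightarrow> 'u rack" where
  "encoded_rack K op =
     \<lparr>carrier = encode ` K, ract = (\<lambda>u v. encode (op (decode u) (decode v)))\<rparr>"

lemma rack_encoded_rack:
  fixes K :: "('u \<times> 'u) set"
  assumes "infinite (UNIV :: 'u set)"
    and "\<And>u v. \<lbrakk>u \<in> K; v \<in> K\<rbrakk> \<Longrightarrow> op u v \<in> K"
    and "\<And>u v. \<lbrakk>u \<in> K; v \<in> K\<rbrakk> \<Longrightarrow> \<exists>w\<in>K. op w v = u"
    and "\<And>u v w. \<lbrakk>u \<in> K; v \<in> K; w \<in> K; op u w = op v w\<rbrakk> \<Longrightarrow> u = v"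
    and "\<And>u v w. \<lbrakk>u \<in> K; v \<in> K; w \<in> K\<rbrakk> \<Longrightarrow> op (op u v) w = op (op u w) (op v w)"
  shows "rack (encoded_rack K op)"
proof
  note [simp] = decode_encode[OF assms(1)]
  have encode_eq [simp]: "encode a = (encode b :: 'u) \<longleftrightarrow> a = b" for a b
    by (metis decode_encode[OF assms(1)])
  fix a b assume "a \<in> carrier (encoded_rack K op)" "b \<in> carrier (encoded_rack K op)"
  then obtain u v where uv: "u \<in> K" "v \<in> K" "a = encode u" "b = encode v"
    by (auto simp: encoded_rack_def)
  show "ract (encoded_rack K op) a b \<in> carrier (encoded_rack K op)"
    using uv assms(2) by (simp add: encoded_rack_def)
  obtain w where "w \<in> K" "op w v = u" using assms(3) uv by blast
  then show "\<exists>!c. c \<in> carrier (encoded_rack K op) \<and> ract (encoded_rack K op) c b = a"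
    using uv assms(4)[of _ w v] by (auto simp: encoded_rack_def intro!: ex1I[of _ "encode w"])
  fix c assume "c \<in> carrier (encoded_rack K op)"
  then show "ract (encoded_rack K op) (ract (encoded_rack K op) a b) c =
    ract (encoded_rack K op) (ract (encoded_rack K op) a c) (ract (encoded_rack K op) b c)"
    using uv assms(2) by (auto simp: encoded_rack_def intro: assms(5))
qed

locale rack_in_infinite_universe = rack X for X :: "'u rack" +
  assumes infinite_universe: "infinite (UNIV :: 'u set)"
begin

abbreviation Over :: "('u rack \<times> ('u \<Rightarrow> 'u), 'u \<Rightarrow> 'u) category" where
  "Over \<equiv> slice_category Rack X"

abbreviation pts :: "'u rack \<times> ('u \<Rightarrow> 'u) \<Rightarrow> 'u set" where
  "pts A \<equiv> carrier (fst A)"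

lemmas decode_encode [simp] = decode_encode[OF infinite_universe]

lemma encode_eq_iff [simp]: "encode a = (encode b :: 'u) \<longleftrightarrow> a = b"
  by (metis decode_encode)

lemma Obj_Over: "A \<in> Obj Over \<longleftrightarrow> rack (fst A) \<and> snd A \<in> rack_hom (fst A) X"
  by (auto simp: slice_category_def Rack_def)

lemma Hom_Over:
  assumes "A \<in> Obj Over"
  shows "f \<in> Hom Over A B \<longleftrightarrow>
    f \<in> rack_hom (fst A) (fst B) \<and> (\<forall>a\<in>pts A. snd B (f a) = snd A a)"
  using assms rack_homD(1)[of "snd A" "fst A" X]
  by (auto simp: Obj_Over slice_category_def Rack_def compose_eq_extensional_iff split: prod.splits)

lemma Ident_Over: "Ident Over A = (\<lambda>a\<in>pts A. a)"
  by (simp add: slice_category_def Rack_def split: prod.splits)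

lemma Comp_Over: "Comp Over A B D g f = compose (pts A) g f"
  by (simp add: slice_category_def Rack_def split: prod.splits)

lemma Over_objD:
  assumes "A \<in> Obj Over"
  shows "rack (fst A)"
    and "a \<in> pts A \<Longrightarrow> snd A a \<in> carrier X"
    and "\<lbrakk>a \<in> pts A; b \<in> pts A\<rbrakk> \<Longrightarrow> ract (fst A) a b \<in> pts A"
    and "\<lbrakk>a \<in> pts A; b \<in> pts A\<rbrakk> \<Longrightarrow> snd A (ract (fst A) a b) = ract X (snd A a) (snd A b)"
  using assms rack_homD(2,3)[of "snd A" "fst A" X] rack.ract_closed by (auto simp: Obj_Over)

lemma Over_homD:
  assumes "f \<in> Hom Over A B" "A \<in> Obj Over"
  shows "f \<in> extensional (pts A)"
    and "a \<in> pts A \<Longrightarrow> f a \<in> pts B"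
    and "a \<in> pts A \<Longrightarrow> snd B (f a) = snd A a"
    and "\<lbrakk>a \<in> pts A; b \<in> pts A\<rbrakk> \<Longrightarrow> f (ract (fst A) a b) = ract (fst B) (f a) (f b)"
  using assms rack_homD[of f "fst A" "fst B"] by (auto simp: Hom_Over)

lemma Over_homI:
  assumes "A \<in> Obj Over" "f \<in> extensional (pts A)"
    and "\<And>a. a \<in> pts A \<Longrightarrow> f a \<in> pts B"
    and "\<And>a. a \<in> pts A \<Longrightarrow> snd B (f a) = snd A a"
    and "\<And>a b. \<lbrakk>a \<in> pts A; b \<in> pts A\<rbrakk> \<Longrightarrow> f (ract (fst A) a b) = ract (fst B) (f a) (f b)"
  shows "f \<in> Hom Over A B"
  using assms by (auto simp: Hom_Over intro: rack_homI)

lemma Over_hom_eqI: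
  assumes "f \<in> Hom Over A B" "g \<in> Hom Over A B'" "A \<in> Obj Over"
    and "\<And>a. a \<in> pts A \<Longrightarrow> f a = g a"
  shows "f = g"
  by (rule extensionalityI[OF Over_homD(1)[OF assms(1,3)] Over_homD(1)[OF assms(2,3)] assms(4)])

lemma category_Over: "category Over"
proof
  fix a assume "a \<in> Obj Over"
  then show "Ident Over a \<in> Hom Over a a"
    by (intro Over_homI) (auto simp: Ident_Over Over_objD)
next
  fix a b c f g
  assume A: "a \<in> Obj Over" "b \<in> Obj Over" "c \<in> Obj Over" "f \<in> Hom Over a b" "g \<in> Hom Over b c"
  then show "Comp Over a b c g f \<in> Hom Over a c"
    using Over_homD[OF A(4,1)] Over_homD[OF A(5,2)]
    by (intro Over_homI) (auto simp: Comp_Over compose_eq Over_objD)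
next
  fix a b f assume A: "a \<in> Obj Over" "b \<in> Obj Over" "f \<in> Hom Over a b"
  show "Comp Over a b b (Ident Over b) f = f" "Comp Over a a b f (Ident Over a) = f"
    using Over_homD[OF A(3,1)]
    by (auto simp: Comp_Over Ident_Over compose_eq_extensional_iff)
next
  fix a b c d f g h
  assume A: "a \<in> Obj Over" "f \<in> Hom Over a b" "b \<in> Obj Over"
  show "Comp Over a b d (Comp Over b c d h g) f = Comp Over a c d h (Comp Over a b c g f)"
    using Over_homD[OF A(2,1)] by (auto simp: Comp_Over compose_eq_iff compose_eq)
qed

subsection \<open>Terminal object\<close>

lemma is_terminal_base: "is_terminal Over (X, \<lambda>x\<in>carrier X. x)"
proof -
  let ?T = "(X, \<lambda>x\<in>carrier X. x)"
  have T: "?T \<in> Obj Over"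
    using rack_axioms by (auto simp: Obj_Over ract_closed intro!: rack_homI)
  moreover have "\<exists>!f. f \<in> Hom Over A ?T" if A: "A \<in> Obj Over" for A
  proof
    show "snd A \<in> Hom Over A ?T"
      using A by (auto simp: Hom_Over Over_objD) (simp add: Obj_Over)
    then show "f = snd A" if f: "f \<in> Hom Over A ?T" for f
      using Over_homD[OF f A] by (intro Over_hom_eqI[OF f _ A]) auto
  qed
  ultimately show ?thesis by (simp add: is_terminal_def)
qed

abbreviation T where "T \<equiv> terminal_obj Over"

lemma is_terminal_T: "is_terminal Over T"
  unfolding terminal_obj_def using is_terminal_base by (rule someI)

lemma T_obj: "T \<in> Obj Over"
  using is_terminal_T by (simp add: is_terminal_def)

lemma to_terminal_hom: "A \<in> Obj Over \<Longrightarrow> to_terminal Over A \<in> Hom Over A T"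
  unfolding to_terminal_def using is_terminal_T
  by (intro theI'[of "\<lambda>f. f \<in> Hom Over A T"]) (simp add: is_terminal_def)

lemma T_hom_unique:
  "\<lbrakk>A \<in> Obj Over; f \<in> Hom Over A T; g \<in> Hom Over A T\<rbrakk> \<Longrightarrow> f = g"
  using is_terminal_T by (auto simp: is_terminal_def)

text \<open>
  The unique arrow from \<open>X\<close> over itself is a section of the structure map of the terminal object;
  it picks the only point of the terminal object over each point of \<open>X\<close>.
\<close>
definition T_point :: "'u \<Rightarrow> 'u" where
  "T_point = to_terminal Over (X, \<lambda>x\<in>carrier X. x)"

lemma T_point:
  assumes "x \<in> carrier X"
  shows "T_point x \<in> pts T" "snd T (T_point x) = x"
  using Over_homD[OF to_terminal_hom] is_terminal_base assms
  by (auto simp: T_point_def is_terminal_def)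

lemma T_point_ract:
  "\<lbrakk>x \<in> carrier X; y \<in> carrier X\<rbrakk> \<Longrightarrow> T_point (ract X x y) = ract (fst T) (T_point x) (T_point y)"
  using Over_homD(4)[OF to_terminal_hom] is_terminal_base
  by (auto simp: T_point_def is_terminal_def)

lemma to_terminal_eq:
  assumes A: "A \<in> Obj Over" and a: "a \<in> pts A"
  shows "to_terminal Over A a = T_point (snd A a)"
proof -
  have "compose (pts A) T_point (snd A) \<in> Hom Over A T"
    using A by (intro Over_homI) (auto simp: compose_eq Over_objD T_point T_point_ract)
  then have "to_terminal Over A = compose (pts A) T_point (snd A)"
    using A to_terminal_hom T_hom_unique by blast
  then show ?thesis using a by (simp add: compose_eq)
qed

lemma T_point_snd: "t \<in> pts T \<Longrightarrow> T_point (snd T t) = t"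
proof -
  assume t: "t \<in> pts T"
  have "Ident Over T = to_terminal Over T"
    using T_obj to_terminal_hom category.ident_in_hom[OF category_Over] T_hom_unique by blast
  then show ?thesis
    using to_terminal_eq[OF T_obj t] t by (metis Ident_Over restrict_apply)
qed

subsection \<open>Fibre products\<close>

definition fibre_pairs where
  "fibre_pairs A B = {(a, b). a \<in> pts A \<and> b \<in> pts B \<and> snd A a = snd B b}"

definition fibre_product where
  "fibre_product A B =
     (encoded_rack (fibre_pairs A B)
        (\<lambda>u v. (ract (fst A) (fst u) (fst v), ract (fst B) (snd u) (snd v))),
      \<lambda>u\<in>encode ` fibre_pairs A B. snd A (fst (decode u)))"

lemma pts_fibre_product: "pts (fibre_product A B) = encode ` fibre_pairs A B"
  by (simp add: fibre_product_def encoded_rack_def)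

text \<open>
  Coordinatewise division stays in the fibre product: the two quotients lie over the same point
  because division in \<open>X\<close> is unique.
\<close>
lemma fibre_product_obj:
  assumes A: "A \<in> Obj Over" and B: "B \<in> Obj Over"
  shows "fibre_product A B \<in> Obj Over"
proof -
  let ?op = "\<lambda>u v. (ract (fst A) (fst u) (fst v), ract (fst B) (snd u) (snd v))"
  interpret A: rack "fst A" using A by (simp add: Obj_Over)
  interpret B: rack "fst B" using B by (simp add: Obj_Over)
  have op: "?op u v \<in> fibre_pairs A B" if "u \<in> fibre_pairs A B" "v \<in> fibre_pairs A B" for u v
    using that A B by (auto simp: fibre_pairs_def Over_objD)
  have "rack (encoded_rack (fibre_pairs A B) ?op)"
  proof (rule rack_encoded_rack)
    show "infinite (UNIV :: 'u set)" by (rule infinite_universe)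
  next
    fix u v assume "u \<in> fibre_pairs A B" "v \<in> fibre_pairs A B"
    then show "?op u v \<in> fibre_pairs A B" by (rule op)
  next
    fix u v assume "u \<in> fibre_pairs A B" "v \<in> fibre_pairs A B"
    then have u: "fst u \<in> pts A" "snd u \<in> pts B" "snd A (fst u) = snd B (snd u)"
      and v: "fst v \<in> pts A" "snd v \<in> pts B" "snd A (fst v) = snd B (snd v)"
      by (auto simp: fibre_pairs_def)
    obtain a where a: "a \<in> pts A" "ract (fst A) a (fst v) = fst u"
      using ex1_implies_ex[OF A.ract_unique[OF u(1) v(1)]] by blast
    obtain b where b: "b \<in> pts B" "ract (fst B) b (snd v) = snd u"
      using ex1_implies_ex[OF B.ract_unique[OF u(2) v(2)]] by blast
    have "ract X (snd A a) (snd A (fst v)) = ract X (snd B b) (snd A (fst v))"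
      using Over_objD(4)[OF A a(1) v(1)] Over_objD(4)[OF B b(1) v(2)] a b u v by simp
    then have "snd A a = snd B b"
      using ract_right_cancel[OF Over_objD(2)[OF A a(1)] Over_objD(2)[OF B b(1)] Over_objD(2)[OF A v(1)]]
      by blast
    with a b show "\<exists>w\<in>fibre_pairs A B. ?op w v = u"
      by (intro bexI[of _ "(a, b)"]) (simp_all add: fibre_pairs_def)
  next
    fix u v w
    assume "u \<in> fibre_pairs A B" "v \<in> fibre_pairs A B" "w \<in> fibre_pairs A B" "?op u w = ?op v w"
    then show "u = v"
      using A.ract_right_cancel[of "fst u" "fst v" "fst w"]
        B.ract_right_cancel[of "snd u" "snd v" "snd w"] by (auto simp: fibre_pairs_def)
  next
    fix u v w
    assume "u \<in> fibre_pairs A B" "v \<in> fibre_pairs A B" "w \<in> fibre_pairs A B"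
    then show "?op (?op u v) w = ?op (?op u w) (?op v w)"
      using A.ract_distrib B.ract_distrib by (auto simp: fibre_pairs_def)
  qed
  moreover have "snd (fibre_product A B) \<in> rack_hom (fst (fibre_product A B)) X"
    using A B op by (intro rack_homI)
      (auto simp: fibre_product_def encoded_rack_def fibre_pairs_def Over_objD)
  ultimately show ?thesis by (simp add: Obj_Over fibre_product_def)
qed

lemma fibre_product_proj1:
  assumes "A \<in> Obj Over" "B \<in> Obj Over"
  shows "(\<lambda>u\<in>pts (fibre_product A B). fst (decode u)) \<in> Hom Over (fibre_product A B) A"
  using assms fibre_product_obj[OF assms] Over_objD(3)[OF fibre_product_obj[OF assms]]
  by (intro Over_homI) (auto simp: fibre_product_def encoded_rack_def fibre_pairs_def Over_objD)

lemma fibre_product_proj2: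
  assumes "A \<in> Obj Over" "B \<in> Obj Over"
  shows "(\<lambda>u\<in>pts (fibre_product A B). snd (decode u)) \<in> Hom Over (fibre_product A B) B"
  using assms fibre_product_obj[OF assms] Over_objD(3)[OF fibre_product_obj[OF assms]]
  by (intro Over_homI) (auto simp: fibre_product_def encoded_rack_def fibre_pairs_def Over_objD)

lemma fibre_product_pairing:
  assumes "R \<in> Obj Over" "A \<in> Obj Over" "B \<in> Obj Over" "f \<in> Hom Over R A" "g \<in> Hom Over R B"
  shows "(\<lambda>t\<in>pts R. encode (f t, g t)) \<in> Hom Over R (fibre_product A B)"
  using assms Over_homD[OF assms(4,1)] Over_homD[OF assms(5,1)]
  by (intro Over_homI)
    (auto simp: fibre_product_def encoded_rack_def fibre_pairs_def Over_objD intro!: imageI)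

lemma is_product_fibre_product:
  assumes A: "A \<in> Obj Over" and B: "B \<in> Obj Over"
  shows "is_product Over A B
    (fibre_product A B, \<lambda>u\<in>pts (fibre_product A B). fst (decode u),
     \<lambda>u\<in>pts (fibre_product A B). snd (decode u))"
proof -
  let ?P = "fibre_product A B"
  let ?p = "\<lambda>u\<in>pts ?P. fst (decode u)" and ?q = "\<lambda>u\<in>pts ?P. snd (decode u)"
  have "\<exists>!h. h \<in> Hom Over R ?P \<and> Comp Over R ?P A ?p h = f \<and> Comp Over R ?P B ?q h = g"
    if R: "R \<in> Obj Over" and f: "f \<in> Hom Over R A" and g: "g \<in> Hom Over R B" for R f g
  proof (rule ex1I[of _ "\<lambda>t\<in>pts R. encode (f t, g t)"])
    show "(\<lambda>t\<in>pts R. encode (f t, g t)) \<in> Hom Over R ?P \<and>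
      Comp Over R ?P A ?p (\<lambda>t\<in>pts R. encode (f t, g t)) = f \<and>
      Comp Over R ?P B ?q (\<lambda>t\<in>pts R. encode (f t, g t)) = g"
      using fibre_product_pairing[OF R A B f g] Over_homD(1)[OF f R] Over_homD(1)[OF g R]
        Over_homD(2)[OF fibre_product_pairing[OF R A B f g] R]
      by (auto simp: Comp_Over compose_eq_extensional_iff)
  next
    fix h assume h: "h \<in> Hom Over R ?P \<and> Comp Over R ?P A ?p h = f \<and> Comp Over R ?P B ?q h = g"
    show "h = (\<lambda>t\<in>pts R. encode (f t, g t))"
    proof (rule Over_hom_eqI[OF _ fibre_product_pairing[OF R A B f g] R])
      fix t assume t: "t \<in> pts R"
      then have ht: "h t \<in> pts ?P" using h Over_homD(2)[OF _ R] by blast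
      have "f t = fst (decode (h t))" "g t = snd (decode (h t))"
        using h ht t by (auto simp: Comp_Over compose_eq)
      moreover obtain z where "h t = encode z"
        using ht by (auto simp: pts_fibre_product)
      ultimately show "h t = (\<lambda>t\<in>pts R. encode (f t, g t)) t"
        using t by simp
    qed (use h in blast)
  qed
  then show ?thesis
    using fibre_product_obj[OF A B] fibre_product_proj1[OF A B] fibre_product_proj2[OF A B]
    by (simp add: is_product_def)
qed

lemma cartesian_Over: "cartesian_category Over"
proof -
  interpret category Over by (rule category_Over)
  show ?thesis
    using is_terminal_base is_product_fibre_product by unfold_locales blast+
qed

lemma is_product_chosen:
  assumes "A \<in> Obj Over" "B \<in> Obj Over"
  shows "is_product Over A B (prod_obj Over A B, proj1 Over A B, proj2 Over A B)"
  using someI[of "is_product Over A B", OF is_product_fibre_product[OF assms]]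
  by (simp add: prod_obj_def proj1_def proj2_def product_cone_def)

lemma chosen_product_universal:
  assumes "A \<in> Obj Over" "B \<in> Obj Over" "R \<in> Obj Over" "f \<in> Hom Over R A" "g \<in> Hom Over R B"
  shows "\<exists>!h. h \<in> Hom Over R (prod_obj Over A B) \<and>
    Comp Over R (prod_obj Over A B) A (proj1 Over A B) h = f \<and>
    Comp Over R (prod_obj Over A B) B (proj2 Over A B) h = g"
  using is_product_chosen[OF assms(1,2)] assms(3-5) by (simp add: is_product_def)

abbreviation P where "P A B \<equiv> prod_obj Over A B"
abbreviation \<pi>1 where "\<pi>1 A B \<equiv> proj1 Over A B"
abbreviation \<pi>2 where "\<pi>2 A B \<equiv> proj2 Over A B"

lemma
  assumes "A \<in> Obj Over" "B \<in> Obj Over"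
  shows P_obj: "P A B \<in> Obj Over"
    and proj1_hom: "\<pi>1 A B \<in> Hom Over (P A B) A"
    and proj2_hom: "\<pi>2 A B \<in> Hom Over (P A B) B"
  using is_product_chosen[OF assms] by (auto simp: is_product_def)

lemma
  assumes "A \<in> Obj Over" "B \<in> Obj Over" "u \<in> pts (P A B)"
  shows proj1_pts: "\<pi>1 A B u \<in> pts A"
    and proj2_pts: "\<pi>2 A B u \<in> pts B"
    and proj1_over: "snd A (\<pi>1 A B u) = snd (P A B) u"
    and proj2_over: "snd B (\<pi>2 A B u) = snd (P A B) u"
  using Over_homD(2,3)[OF proj1_hom[OF assms(1,2)] P_obj[OF assms(1,2)] assms(3)]
    Over_homD(2,3)[OF proj2_hom[OF assms(1,2)] P_obj[OF assms(1,2)] assms(3)] by simp_all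

lemma P_hom_unique:
  assumes A: "A \<in> Obj Over" and B: "B \<in> Obj Over" and R: "R \<in> Obj Over"
    and h: "h \<in> Hom Over R (P A B)" and k: "k \<in> Hom Over R (P A B)"
    and eq: "compose (pts R) (\<pi>1 A B) h = compose (pts R) (\<pi>1 A B) k"
      "compose (pts R) (\<pi>2 A B) h = compose (pts R) (\<pi>2 A B) k"
  shows "h = k"
proof -
  note A' = category.comp_in_hom[OF category_Over R P_obj[OF A B] A h proj1_hom[OF A B]]
    and B' = category.comp_in_hom[OF category_Over R P_obj[OF A B] B h proj2_hom[OF A B]]
  show ?thesis
    by (rule ex1E[OF chosen_product_universal[OF A B R A' B']]) (metis h k eq Comp_Over)
qed

text \<open>
  The maps between the chosen product and the fibre product that are induced by the projections
  compose to the identity of the chosen product. The one into the fibre product only depends on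
  coordinates.
\<close>
lemma P_point_unique:
  assumes A: "A \<in> Obj Over" and B: "B \<in> Obj Over"
    and u: "u \<in> pts (P A B)" "v \<in> pts (P A B)" "\<pi>1 A B u = \<pi>1 A B v" "\<pi>2 A B u = \<pi>2 A B v"
  shows "u = v"
proof -
  let ?K = "fibre_product A B"
  let ?k1 = "\<lambda>u\<in>pts ?K. fst (decode u)" and ?k2 = "\<lambda>u\<in>pts ?K. snd (decode u)"
  note P = P_obj[OF A B] and K = fibre_product_obj[OF A B]
  obtain h where h: "h \<in> Hom Over ?K (P A B)" "Comp Over ?K (P A B) A (\<pi>1 A B) h = ?k1"
      "Comp Over ?K (P A B) B (\<pi>2 A B) h = ?k2"
    using ex1_implies_ex[OF chosen_product_universal[OF A B K fibre_product_proj1[OF A B]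
      fibre_product_proj2[OF A B]]] by auto
  let ?g = "\<lambda>u\<in>pts (P A B). encode (\<pi>1 A B u, \<pi>2 A B u)"
  have g: "?g \<in> Hom Over (P A B) ?K"
    using fibre_product_pairing[OF P A B proj1_hom[OF A B] proj2_hom[OF A B]] .
  note hg = category.comp_in_hom[OF category_Over P K P g h(1)]
  have hz: "\<pi>1 A B (h z) = fst (decode z)" "\<pi>2 A B (h z) = snd (decode z)" if "z \<in> pts ?K" for z
    using h(2,3) that by (auto simp: Comp_Over compose_eq_restrict_iff)
  have gw: "encode (\<pi>1 A B w, \<pi>2 A B w) \<in> pts ?K" if "w \<in> pts (P A B)" for w
    using Over_homD(2)[OF g P that] that by simp
  have "Comp Over (P A B) ?K (P A B) h ?g = Ident Over (P A B)"
  proof (rule P_hom_unique[OF A B P hg category.ident_in_hom[OF category_Over P]])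
    show "compose (pts (P A B)) (\<pi>1 A B) (Comp Over (P A B) ?K (P A B) h ?g) =
        compose (pts (P A B)) (\<pi>1 A B) (Ident Over (P A B))"
      unfolding compose_eq_iff Comp_Over Ident_Over using hz(1)[OF gw] by (simp add: compose_eq)
    show "compose (pts (P A B)) (\<pi>2 A B) (Comp Over (P A B) ?K (P A B) h ?g) =
        compose (pts (P A B)) (\<pi>2 A B) (Ident Over (P A B))"
      unfolding compose_eq_iff Comp_Over Ident_Over using hz(2)[OF gw] by (simp add: compose_eq)
  qed
  then have "h (?g w) = w" if "w \<in> pts (P A B)" for w
    using that unfolding Comp_Over Ident_Over compose_eq_restrict_iff by blast
  from this[OF u(1)] this[OF u(2)] show "u = v"
    using u by simp
qed

text \<open>
  The point of the chosen product with given coordinates. It exists when the coordinates lie over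
  the same point of \<open>X\<close>; the value is unspecified otherwise.
\<close>
definition pair_point where
  "pair_point A B a b = (THE u. u \<in> pts (P A B) \<and> \<pi>1 A B u = a \<and> \<pi>2 A B u = b)"

lemma pair_point:
  assumes A: "A \<in> Obj Over" and B: "B \<in> Obj Over"
    and ab: "a \<in> pts A" "b \<in> pts B" "snd A a = snd B b"
  shows "pair_point A B a b \<in> pts (P A B)" "\<pi>1 A B (pair_point A B a b) = a"
    "\<pi>2 A B (pair_point A B a b) = b"
proof -
  let ?K = "fibre_product A B"
  let ?k1 = "\<lambda>u\<in>pts ?K. fst (decode u)" and ?k2 = "\<lambda>u\<in>pts ?K. snd (decode u)"
  note K = fibre_product_obj[OF A B]
  obtain h where h: "h \<in> Hom Over ?K (P A B)" "Comp Over ?K (P A B) A (\<pi>1 A B) h = ?k1"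
      "Comp Over ?K (P A B) B (\<pi>2 A B) h = ?k2"
    using ex1_implies_ex[OF chosen_product_universal[OF A B K fibre_product_proj1[OF A B]
      fibre_product_proj2[OF A B]]] by auto
  have z: "encode (a, b) \<in> pts ?K"
    using ab by (auto simp: pts_fibre_product fibre_pairs_def)
  have "h (encode (a, b)) \<in> pts (P A B) \<and> \<pi>1 A B (h (encode (a, b))) = a \<and>
      \<pi>2 A B (h (encode (a, b))) = b"
    using h(2,3) z Over_homD(2)[OF h(1) K z] by (auto simp: Comp_Over compose_eq_restrict_iff)
  then have "\<exists>!u. u \<in> pts (P A B) \<and> \<pi>1 A B u = a \<and> \<pi>2 A B u = b"
    using P_point_unique[OF A B] by metis
  from theI'[OF this] show "pair_point A B a b \<in> pts (P A B)" "\<pi>1 A B (pair_point A B a b) = a"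
    "\<pi>2 A B (pair_point A B a b) = b"
    by (simp_all add: pair_point_def)
qed

lemma pair_point_proj:
  assumes "A \<in> Obj Over" "B \<in> Obj Over" "u \<in> pts (P A B)"
  shows "pair_point A B (\<pi>1 A B u) (\<pi>2 A B u) = u"
proof -
  have "snd A (\<pi>1 A B u) = snd B (\<pi>2 A B u)"
    using proj1_over[OF assms] proj2_over[OF assms] by simp
  note pp = pair_point[OF assms(1,2) proj1_pts[OF assms] proj2_pts[OF assms] this]
  show ?thesis
    by (rule P_point_unique[OF assms(1,2) pp(1) assms(3) pp(2,3)])
qed

lemma pair_point_over:
  assumes "A \<in> Obj Over" "B \<in> Obj Over" "a \<in> pts A" "b \<in> pts B" "snd A a = snd B b"
  shows "snd (P A B) (pair_point A B a b) = snd B b"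
  using pair_point(3)[OF assms] proj2_over[OF assms(1,2) pair_point(1)[OF assms]] by simp

text \<open>
  The rule by which an equation of arrows out of a chosen product becomes a law for pairs of points.
\<close>
lemma ball_P_iff:
  assumes A: "A \<in> Obj Over" and B: "B \<in> Obj Over"
  shows "(\<forall>u\<in>pts (P A B). \<Phi> u) \<longleftrightarrow>
    (\<forall>a\<in>pts A. \<forall>b\<in>pts B. snd A a = snd B b \<longrightarrow> \<Phi> (pair_point A B a b))"
proof (intro iffI ballI impI)
  fix u assume *: "\<forall>a\<in>pts A. \<forall>b\<in>pts B. snd A a = snd B b \<longrightarrow> \<Phi> (pair_point A B a b)"
    and u: "u \<in> pts (P A B)"
  have "\<Phi> (pair_point A B (\<pi>1 A B u) (\<pi>2 A B u))"
    using * proj1_pts[OF A B u] proj2_pts[OF A B u] proj1_over[OF A B u] proj2_over[OF A B u] by simp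
  then show "\<Phi> u" using pair_point_proj[OF A B u] by simp
qed (use pair_point(1)[OF A B] in blast)

lemma pair_point_ract:
  assumes A: "A \<in> Obj Over" and B: "B \<in> Obj Over"
    and ab: "a \<in> pts A" "b \<in> pts B" "snd A a = snd B b"
    and cd: "c \<in> pts A" "d \<in> pts B" "snd A c = snd B d"
  shows "ract (fst (P A B)) (pair_point A B a b) (pair_point A B c d) =
    pair_point A B (ract (fst A) a c) (ract (fst B) b d)"
proof (rule P_point_unique[OF A B])
  note P = P_obj[OF A B] and u = pair_point[OF A B ab] and v = pair_point[OF A B cd]
  have "ract (fst A) a c \<in> pts A" "ract (fst B) b d \<in> pts B"
    "snd A (ract (fst A) a c) = snd B (ract (fst B) b d)"
    using A B ab cd by (auto simp: Over_objD)
  note w = pair_point[OF A B this]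
  show "ract (fst (P A B)) (pair_point A B a b) (pair_point A B c d) \<in> pts (P A B)"
    using Over_objD(3)[OF P] u v by blast
  show "\<pi>1 A B (ract (fst (P A B)) (pair_point A B a b) (pair_point A B c d)) =
    \<pi>1 A B (pair_point A B (ract (fst A) a c) (ract (fst B) b d))"
    using Over_homD(4)[OF proj1_hom[OF A B] P u(1) v(1)] u v w by simp
  show "\<pi>2 A B (ract (fst (P A B)) (pair_point A B a b) (pair_point A B c d)) =
    \<pi>2 A B (pair_point A B (ract (fst A) a c) (ract (fst B) b d))"
    using Over_homD(4)[OF proj2_hom[OF A B] P u(1) v(1)] u v w by simp
qed (use assms pair_point in \<open>simp add: Over_objD\<close>)

lemma
  assumes R: "R \<in> Obj Over" and A: "A \<in> Obj Over" and B: "B \<in> Obj Over"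
    and f: "f \<in> Hom Over R A" and g: "g \<in> Hom Over R B"
  shows pairing_hom: "pairing Over R A B f g \<in> Hom Over R (P A B)"
    and pairing_eq: "t \<in> pts R \<Longrightarrow> pairing Over R A B f g t = pair_point A B (f t) (g t)"
proof -
  have "\<exists>!h. h \<in> Hom Over R (P A B) \<and> Comp Over R (P A B) A (\<pi>1 A B) h = f \<and>
      Comp Over R (P A B) B (\<pi>2 A B) h = g"
    by (rule chosen_product_universal[OF A B R f g])
  from theI'[OF this] have h: "pairing Over R A B f g \<in> Hom Over R (P A B)"
    "compose (pts R) (\<pi>1 A B) (pairing Over R A B f g) = f"
    "compose (pts R) (\<pi>2 A B) (pairing Over R A B f g) = g"
    by (simp_all add: pairing_def Comp_Over)
  show "pairing Over R A B f g \<in> Hom Over R (P A B)" by (rule h)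
  assume t: "t \<in> pts R"
  have "\<pi>1 A B (pairing Over R A B f g t) = f t" "\<pi>2 A B (pairing Over R A B f g t) = g t"
    using h(2,3) t by (metis compose_eq)+
  then show "pairing Over R A B f g t = pair_point A B (f t) (g t)"
    using pair_point_proj[OF A B Over_homD(2)[OF h(1) R t]] by simp
qed

end

section \<open>Abelian group objects as fibrewise Abelian groups\<close>

context rack_in_infinite_universe
begin

subsection \<open>The group object equations at points\<close>

lemma P_hom_pair_point:
  assumes A: "A \<in> Obj Over" and m: "m \<in> Hom Over (P A A) A"
    and ab: "a \<in> pts A" "b \<in> pts A" "snd A a = snd A b"
  shows "m (pair_point A A a b) \<in> pts A" "snd A (m (pair_point A A a b)) = snd A b"
  using Over_homD(2,3)[OF m P_obj[OF A A] pair_point(1)[OF A A ab]]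
    pair_point_over[OF A A ab] by simp_all

text \<open>
  Each point of the chosen product \<open>(A \<times> A) \<times> A\<close> is a nested pair of points of \<open>A\<close> in one fibre,
  and the two composites send it to \<open>(a + b) + c\<close> and \<open>a + (b + c)\<close>.
\<close>
lemma assoc_iff:
  assumes A: "A \<in> Obj Over" and m: "m \<in> Hom Over (P A A) A"
  shows "Comp Over (P (P A A) A) (P A A) A m
      (pairing Over (P (P A A) A) A A
        (Comp Over (P (P A A) A) (P A A) A m (\<pi>1 (P A A) A)) (\<pi>2 (P A A) A)) =
    Comp Over (P (P A A) A) (P A A) A m
      (pairing Over (P (P A A) A) A A
        (Comp Over (P (P A A) A) (P A A) A (\<pi>1 A A) (\<pi>1 (P A A) A))
        (Comp Over (P (P A A) A) (P A A) A m
          (pairing Over (P (P A A) A) A A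
            (Comp Over (P (P A A) A) (P A A) A (\<pi>2 A A) (\<pi>1 (P A A) A)) (\<pi>2 (P A A) A)))) \<longleftrightarrow>
    (\<forall>a\<in>pts A. \<forall>b\<in>pts A. snd A a = snd A b \<longrightarrow> (\<forall>c\<in>pts A. snd A b = snd A c \<longrightarrow>
      m (pair_point A A (m (pair_point A A a b)) c) =
      m (pair_point A A a (m (pair_point A A b c)))))"
    (is "?lhs = ?rhs")
proof -
  let ?Q = "P (P A A) A"
  note PA = P_obj[OF A A]
  note Q = P_obj[OF PA A]
  note comp = category.comp_in_hom[OF category_Over Q PA A]
  note q1 = proj1_hom[OF PA A] and q2 = proj2_hom[OF PA A]
  note mq = comp[OF q1 m] and pq = comp[OF q1 proj1_hom[OF A A]] and rq = comp[OF q1 proj2_hom[OF A A]]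
  note inner = comp[OF pairing_hom[OF Q A A rq q2] m]
  define l where "l = pairing Over ?Q A A (Comp Over ?Q (P A A) A m (\<pi>1 (P A A) A)) (\<pi>2 (P A A) A)"
  define r where "r = pairing Over ?Q A A
        (Comp Over ?Q (P A A) A (\<pi>1 A A) (\<pi>1 (P A A) A))
        (Comp Over ?Q (P A A) A m
          (pairing Over ?Q A A
            (Comp Over ?Q (P A A) A (\<pi>2 A A) (\<pi>1 (P A A) A)) (\<pi>2 (P A A) A)))"
  have l: "l (pair_point (P A A) A (pair_point A A a b) c) =
      pair_point A A (m (pair_point A A a b)) c"
    and r: "r (pair_point (P A A) A (pair_point A A a b) c) =
      pair_point A A a (m (pair_point A A b c))"
    if "a \<in> pts A" "b \<in> pts A" "snd A a = snd A b" "c \<in> pts A" "snd A b = snd A c" for a b c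
  proof -
    note u = pair_point[OF A A that(1-3)]
    have "snd (P A A) (pair_point A A a b) = snd A c"
      using pair_point_over[OF A A that(1-3)] that(5) by simp
    note q = pair_point[OF PA A u(1) that(4) this]
    show "l (pair_point (P A A) A (pair_point A A a b) c) = pair_point A A (m (pair_point A A a b)) c"
      unfolding l_def pairing_eq[OF Q A A mq q2 q(1)]
      using q by (simp add: Comp_Over compose_eq)
    show "r (pair_point (P A A) A (pair_point A A a b) c) = pair_point A A a (m (pair_point A A b c))"
      unfolding r_def pairing_eq[OF Q A A pq inner q(1)]
      using q u by (simp add: Comp_Over compose_eq pairing_eq[OF Q A A rq q2 q(1), unfolded Comp_Over])
  qed
  have "?lhs \<longleftrightarrow> compose (pts ?Q) m l = compose (pts ?Q) m r"
    unfolding l_def r_def Comp_Over ..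
  also have "\<dots> \<longleftrightarrow> (\<forall>q\<in>pts ?Q. m (l q) = m (r q))"
    by (rule compose_eq_iff)
  also have "\<dots> \<longleftrightarrow> (\<forall>a\<in>pts A. \<forall>b\<in>pts A. snd A a = snd A b \<longrightarrow>
      (\<forall>c\<in>pts A. snd (P A A) (pair_point A A a b) = snd A c \<longrightarrow>
        m (l (pair_point (P A A) A (pair_point A A a b) c)) =
        m (r (pair_point (P A A) A (pair_point A A a b) c))))"
    unfolding ball_P_iff[OF PA A] ball_P_iff[OF A A] ..
  also have "\<dots> \<longleftrightarrow> ?rhs"
    using l r by (simp add: pair_point_over[OF A A] cong: ball_cong imp_cong)
  finally show ?thesis .
qed

text \<open>
  The common shape of the unit laws and the inverse laws.
\<close>
lemma comp_pairing_iff: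
  assumes A: "A \<in> Obj Over" and f: "f \<in> Hom Over A A" and g: "g \<in> Hom Over A A"
    and k: "k \<in> Hom Over A A"
  shows "Comp Over A (P A A) A m (pairing Over A A A f g) = k \<longleftrightarrow>
    (\<forall>a\<in>pts A. m (pair_point A A (f a) (g a)) = k a)"
  unfolding Comp_Over compose_eq_extensional_iff[OF Over_homD(1)[OF k A]]
  using pairing_eq[OF A A A f g] by simp

lemma comm_iff:
  assumes A: "A \<in> Obj Over" and m: "m \<in> Hom Over (P A A) A"
  shows "Comp Over (P A A) (P A A) A m (pairing Over (P A A) A A (\<pi>2 A A) (\<pi>1 A A)) = m \<longleftrightarrow>
    (\<forall>a\<in>pts A. \<forall>b\<in>pts A. snd A a = snd A b \<longrightarrow>
      m (pair_point A A b a) = m (pair_point A A a b))"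
proof -
  note PA = P_obj[OF A A]
  have "pairing Over (P A A) A A (\<pi>2 A A) (\<pi>1 A A) (pair_point A A a b) = pair_point A A b a"
    if "a \<in> pts A" "b \<in> pts A" "snd A a = snd A b" for a b
    using pairing_eq[OF PA A A proj2_hom[OF A A] proj1_hom[OF A A] pair_point(1)[OF A A that]]
      pair_point[OF A A that] by simp
  then show ?thesis
    unfolding Comp_Over compose_eq_extensional_iff[OF Over_homD(1)[OF m PA]] ball_P_iff[OF A A]
    by simp
qed

text \<open>
  The group structure of a group object, read off at points.
\<close>
definition gadd where "gadd G a b = gmul G (pair_point (gobj G) (gobj G) a b)"
definition gzero where "gzero G x = gone G (T_point x)"

lemma is_ab_group_object_iff:
  "is_ab_group_object Over G \<longleftrightarrow>
     gobj G \<in> Obj Over \<and> gmul G \<in> Hom Over (P (gobj G) (gobj G)) (gobj G) \<and>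
     gone G \<in> Hom Over T (gobj G) \<and> ginv G \<in> Hom Over (gobj G) (gobj G) \<and>
     (\<forall>a\<in>pts (gobj G). \<forall>b\<in>pts (gobj G). snd (gobj G) a = snd (gobj G) b \<longrightarrow>
       (\<forall>c\<in>pts (gobj G). snd (gobj G) b = snd (gobj G) c \<longrightarrow>
         gadd G (gadd G a b) c = gadd G a (gadd G b c))) \<and>
     (\<forall>a\<in>pts (gobj G). gadd G (gzero G (snd (gobj G) a)) a = a) \<and>
     (\<forall>a\<in>pts (gobj G). gadd G a (gzero G (snd (gobj G) a)) = a) \<and>
     (\<forall>a\<in>pts (gobj G). gadd G (ginv G a) a = gzero G (snd (gobj G) a)) \<and>
     (\<forall>a\<in>pts (gobj G). gadd G a (ginv G a) = gzero G (snd (gobj G) a)) \<and>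
     (\<forall>a\<in>pts (gobj G). \<forall>b\<in>pts (gobj G). snd (gobj G) a = snd (gobj G) b \<longrightarrow>
       gadd G b a = gadd G a b)"
proof (cases "gobj G \<in> Obj Over \<and> gmul G \<in> Hom Over (P (gobj G) (gobj G)) (gobj G) \<and>
     gone G \<in> Hom Over T (gobj G) \<and> ginv G \<in> Hom Over (gobj G) (gobj G)")
  case True
  define A where "A = gobj G"
  have A: "A \<in> Obj Over" and m: "gmul G \<in> Hom Over (P A A) A"
    and e: "gone G \<in> Hom Over T A" and i: "ginv G \<in> Hom Over A A"
    using True by (auto simp: A_def)
  define e' where "e' = Comp Over A T A (gone G) (to_terminal Over A)"
  have e': "e' \<in> Hom Over A A"
    unfolding e'_def by (rule category.comp_in_hom[OF category_Over A T_obj A to_terminal_hom[OF A] e])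
  have e'_eq: "e' a = gzero G (snd A a)" if "a \<in> pts A" for a
    using that by (simp add: e'_def Comp_Over compose_eq to_terminal_eq[OF A] gzero_def)
  have id: "Ident Over A \<in> Hom Over A A"
    by (rule category.ident_in_hom[OF category_Over A])
  have id_eq: "Ident Over A a = a" if "a \<in> pts A" for a
    using that by (simp add: Ident_Over)
  show ?thesis
    unfolding is_ab_group_object_def is_group_object_def Let_def A_def[symmetric]
      assoc_iff[OF A m] comm_iff[OF A m] e'_def[symmetric]
      comp_pairing_iff[OF A e' id id] comp_pairing_iff[OF A id e' id]
      comp_pairing_iff[OF A i id e'] comp_pairing_iff[OF A id i e'] gadd_def
    using A m e i cartesian_Over by (simp add: e'_eq id_eq cong: ball_cong)
next
  case False
  then show ?thesis
    by (auto simp: is_ab_group_object_def is_group_object_def Let_def)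
qed

definition fibre_group ::
    "'u rack \<times> ('u \<Rightarrow> 'u) \<Rightarrow> ('u \<Rightarrow> 'u \<Rightarrow> 'u) \<Rightarrow> ('u \<Rightarrow> 'u) \<Rightarrow> 'u \<Rightarrow> 'u monoid" where
  "fibre_group B add zero x = \<lparr>carrier = {b \<in> pts B. snd B b = x}, mult = add, one = zero x\<rparr>"

end

text \<open>
  The pointwise form of an Abelian group object over \<open>X\<close>. That the zero section and the inverse are
  rack homomorphisms follows from \<open>add_ract\<close>; see \<open>zero_ract\<close> and \<open>neg_ract\<close>.
\<close>
locale fibrewise_ab_group = rack_in_infinite_universe X for X :: "'u rack" +
  fixes B :: "'u rack \<times> ('u \<Rightarrow> 'u)" and add :: "'u \<Rightarrow> 'u \<Rightarrow> 'u" and zero :: "'u \<Rightarrow> 'u"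
  assumes total_obj: "B \<in> Obj Over"
    and fibre_comm_group: "x \<in> carrier X \<Longrightarrow> comm_group (fibre_group B add zero x)"
    and add_ract: "\<lbrakk>a \<in> pts B; b \<in> pts B; c \<in> pts B; d \<in> pts B; snd B a = snd B b; snd B c = snd B d\<rbrakk>
      \<Longrightarrow> ract (fst B) (add a b) (add c d) = add (ract (fst B) a c) (ract (fst B) b d)"
begin

abbreviation fibre where "fibre \<equiv> fibre_group B add zero"

abbreviation neg where "neg a \<equiv> inv\<^bsub>fibre (snd B a)\<^esub> a"

lemma fibre_group_group: "x \<in> carrier X \<Longrightarrow> group (fibre x)"
  using fibre_comm_group by (simp add: comm_group_def)

lemma add_point:
  assumes "a \<in> pts B" "b \<in> pts B" "snd B a = snd B b"
  shows "add a b \<in> pts B" "snd B (add a b) = snd B b"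
proof -
  interpret comm_group "fibre (snd B b)"
    using assms total_obj by (intro fibre_comm_group) (simp add: Over_objD)
  show "add a b \<in> pts B" "snd B (add a b) = snd B b"
    using m_closed[of a b] assms by (auto simp: fibre_group_def)
qed

lemma zero_point:
  assumes "x \<in> carrier X"
  shows "zero x \<in> pts B" "snd B (zero x) = x"
  using group.is_monoid[OF fibre_group_group[OF assms], THEN monoid.one_closed]
  by (auto simp: fibre_group_def)

lemma add_zero:
  assumes "a \<in> pts B"
  shows "add (zero (snd B a)) a = a" "add a (zero (snd B a)) = a"
proof -
  interpret comm_group "fibre (snd B a)"
    using assms total_obj by (intro fibre_comm_group) (simp add: Over_objD)
  show "add (zero (snd B a)) a = a" "add a (zero (snd B a)) = a"
    using l_one[of a] r_one[of a] assms by (auto simp: fibre_group_def)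
qed

lemma neg_point:
  assumes "a \<in> pts B"
  shows "neg a \<in> pts B" "snd B (neg a) = snd B a"
    "add (neg a) a = zero (snd B a)" "add a (neg a) = zero (snd B a)"
proof -
  interpret comm_group "fibre (snd B a)"
    using assms total_obj by (intro fibre_comm_group) (simp add: Over_objD)
  have "a \<in> carrier (fibre (snd B a))" using assms by (simp add: fibre_group_def)
  from inv_closed[OF this] l_inv[OF this] r_inv[OF this]
  show "neg a \<in> pts B" "snd B (neg a) = snd B a"
    "add (neg a) a = zero (snd B a)" "add a (neg a) = zero (snd B a)"
    by (simp_all add: fibre_group_def)
qed

lemma add_idem_zero:
  assumes "a \<in> pts B" "add a a = a"
  shows "a = zero (snd B a)"
proof -
  interpret comm_group "fibre (snd B a)"
    using assms total_obj by (intro fibre_comm_group) (simp add: Over_objD)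
  show ?thesis
    using l_cancel_one[of a a] assms by (auto simp: fibre_group_def)
qed

text \<open>
  Addition respects the operation and \<open>0 + 0 = 0\<close>, so a zero acted on by a zero is idempotent in
  its fibre.
\<close>
lemma zero_ract:
  assumes "x \<in> carrier X" "y \<in> carrier X"
  shows "ract (fst B) (zero x) (zero y) = zero (ract X x y)"
proof -
  note x = zero_point[OF assms(1)] and y = zero_point[OF assms(2)]
  let ?z = "ract (fst B) (zero x) (zero y)"
  have "add ?z ?z = ract (fst B) (add (zero x) (zero x)) (add (zero y) (zero y))"
    using x y by (intro add_ract[symmetric]) auto
  also have "\<dots> = ?z"
    using add_zero(1)[OF x(1)] add_zero(1)[OF y(1)] x y by simp
  finally show ?thesis
    using add_idem_zero[of ?z] Over_objD[OF total_obj] x y by simp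
qed

text \<open>
  The sum of \<open>(-a)\<close> acted on by \<open>(-b)\<close> and of \<open>a\<close> acted on by \<open>b\<close> is a zero acted on by a zero.
\<close>
lemma neg_ract:
  assumes a: "a \<in> pts B" and b: "b \<in> pts B"
  shows "neg (ract (fst B) a b) = ract (fst B) (neg a) (neg b)"
proof -
  note na = neg_point[OF a] and nb = neg_point[OF b]
  note objD = Over_objD[OF total_obj]
  have ab: "ract (fst B) a b \<in> pts B" using a b objD by simp
  have "add (ract (fst B) (neg a) (neg b)) (ract (fst B) a b) =
      ract (fst B) (add (neg a) a) (add (neg b) b)"
    using a b na nb by (intro add_ract[symmetric]) auto
  also have "\<dots> = zero (snd B (ract (fst B) a b))"
    using a b na nb objD by (simp add: zero_ract)
  finally show ?thesis
    using ab a b na nb objD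
    by (intro group.inv_equality[OF fibre_group_group]) (simp_all add: fibre_group_def ract_closed)
qed

definition group_object :: "('u rack \<times> ('u \<Rightarrow> 'u), 'u \<Rightarrow> 'u) group_obj" where
  "group_object = \<lparr>gobj = B, gmul = (\<lambda>u\<in>pts (P B B). add (\<pi>1 B B u) (\<pi>2 B B u)),
     gone = (\<lambda>t\<in>pts T. zero (snd T t)), ginv = (\<lambda>b\<in>pts B. neg b)\<rparr>"

lemma gobj_group_object [simp]: "gobj group_object = B"
  by (simp add: group_object_def)

lemma gadd_group_object:
  "\<lbrakk>a \<in> pts B; b \<in> pts B; snd B a = snd B b\<rbrakk> \<Longrightarrow> gadd group_object a b = add a b"
  using pair_point[OF total_obj total_obj] by (simp add: gadd_def group_object_def)

lemma gzero_group_object: "x \<in> carrier X \<Longrightarrow> gzero group_object x = zero x"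
  using T_point by (simp add: gzero_def group_object_def)

lemma is_ab_group_object_group_object: "is_ab_group_object Over group_object"
proof -
  note objD = Over_objD[OF total_obj]
  note PB = P_obj[OF total_obj total_obj]
  note proj = proj1_pts[OF total_obj total_obj] proj2_pts[OF total_obj total_obj]
    proj1_over[OF total_obj total_obj] proj2_over[OF total_obj total_obj]
  have mul: "gmul group_object \<in> Hom Over (P B B) B"
  proof (rule Over_homI[OF PB])
    fix u v assume u: "u \<in> pts (P B B)" and v: "v \<in> pts (P B B)"
    have "\<pi>1 B B (ract (fst (P B B)) u v) = ract (fst B) (\<pi>1 B B u) (\<pi>1 B B v)"
      "\<pi>2 B B (ract (fst (P B B)) u v) = ract (fst B) (\<pi>2 B B u) (\<pi>2 B B v)"
      using Over_homD(4)[OF proj1_hom[OF total_obj total_obj] PB u v]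
        Over_homD(4)[OF proj2_hom[OF total_obj total_obj] PB u v] by simp_all
    then show "gmul group_object (ract (fst (P B B)) u v) =
        ract (fst B) (gmul group_object u) (gmul group_object v)"
      using u v proj Over_objD(3)[OF PB u v] by (simp add: group_object_def add_ract)
  qed (use proj add_point in \<open>simp_all add: group_object_def\<close>)
  have one: "gone group_object \<in> Hom Over T B"
    using zero_point zero_ract Over_objD[OF T_obj]
    by (intro Over_homI[OF T_obj]) (simp_all add: group_object_def)
  have inverse: "ginv group_object \<in> Hom Over B B"
    using neg_point neg_ract objD
    by (intro Over_homI[OF total_obj]) (simp_all add: group_object_def)
  have ginv: "ginv group_object a = neg a" if "a \<in> pts B" for a
    using that by (simp add: group_object_def)
  have assoc: "add (add a b) c = add a (add b c)" and comm: "add b a = add a b"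
    if "a \<in> pts B" "b \<in> pts B" "c \<in> pts B" "snd B a = snd B b" "snd B b = snd B c" for a b c
  proof -
    interpret comm_group "fibre (snd B c)"
      using that objD by (intro fibre_comm_group) simp
    show "add (add a b) c = add a (add b c)" "add b a = add a b"
      using m_assoc[of a b c] m_comm[of b a] that by (simp_all add: fibre_group_def)
  qed
  show ?thesis
    unfolding is_ab_group_object_iff gobj_group_object
  proof (intro conjI ballI impI)
    fix a b c assume abc: "a \<in> pts B" "b \<in> pts B" "snd B a = snd B b" "c \<in> pts B" "snd B b = snd B c"
    then show "gadd group_object (gadd group_object a b) c =
        gadd group_object a (gadd group_object b c)"
      using assoc[of a b c] add_point[of a b] add_point[of b c] by (simp add: gadd_group_object)
  next
    fix a assume a: "a \<in> pts B"
    then have z: "zero (snd B a) \<in> pts B" "snd B (zero (snd B a)) = snd B a"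
      using zero_point objD by simp_all
    show "gadd group_object (gzero group_object (snd B a)) a = a"
      "gadd group_object a (gzero group_object (snd B a)) = a"
      using a z objD add_zero by (simp_all add: gadd_group_object gzero_group_object)
    show "gadd group_object (ginv group_object a) a = gzero group_object (snd B a)"
      "gadd group_object a (ginv group_object a) = gzero group_object (snd B a)"
      using a neg_point[OF a] objD by (simp_all add: gadd_group_object gzero_group_object ginv)
  next
    fix a b assume "a \<in> pts B" "b \<in> pts B" "snd B a = snd B b"
    then show "gadd group_object b a = gadd group_object a b"
      using comm[of a b b] by (simp add: gadd_group_object)
  qed (use total_obj mul one inverse in auto)
qed

end

context rack_in_infinite_universe
begin

lemma fibrewise_ab_group_of_group_object:
  assumes "is_ab_group_object Over G"
  shows "fibrewise_ab_group X (gobj G) (gadd G) (gzero G)"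
proof (intro fibrewise_ab_group.intro fibrewise_ab_group_axioms.intro)
  show "rack_in_infinite_universe X" ..
  define B where "B = gobj G"
  note G = assms[unfolded is_ab_group_object_iff, folded B_def]
  have B: "B \<in> Obj Over" and m: "gmul G \<in> Hom Over (P B B) B"
    and e: "gone G \<in> Hom Over T B" and i: "ginv G \<in> Hom Over B B" using G by auto
  show "gobj G \<in> Obj Over" using B by (simp add: B_def)
  have add: "gadd G a b \<in> pts B" "snd B (gadd G a b) = snd B b"
    if "a \<in> pts B" "b \<in> pts B" "snd B a = snd B b" for a b
    using P_hom_pair_point[OF B m that] by (simp_all add: gadd_def B_def)
  have zero: "gzero G x \<in> pts B" "snd B (gzero G x) = x" if "x \<in> carrier X" for x
    using Over_homD(2,3)[OF e T_obj T_point(1)[OF that]] T_point(2)[OF that]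
    by (simp_all add: gzero_def)
  show "comm_group (fibre_group (gobj G) (gadd G) (gzero G) x)" if x: "x \<in> carrier X" for x
    unfolding B_def[symmetric]
  proof (rule comm_groupI)
    fix a assume a: "a \<in> carrier (fibre_group B (gadd G) (gzero G) x)"
    then show "\<exists>y\<in>carrier (fibre_group B (gadd G) (gzero G) x).
        y \<otimes>\<^bsub>fibre_group B (gadd G) (gzero G) x\<^esub> a = \<one>\<^bsub>fibre_group B (gadd G) (gzero G) x\<^esub>"
      using G Over_homD(2,3)[OF i B, of a] by (intro bexI[of _ "ginv G a"]) (auto simp: fibre_group_def)
  qed (use G add zero x in \<open>auto simp: fibre_group_def\<close>)
  fix a b c d
  assume "a \<in> pts (gobj G)" "b \<in> pts (gobj G)" "c \<in> pts (gobj G)" "d \<in> pts (gobj G)"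
    "snd (gobj G) a = snd (gobj G) b" "snd (gobj G) c = snd (gobj G) d"
  then have ab: "a \<in> pts B" "b \<in> pts B" "snd B a = snd B b"
    and cd: "c \<in> pts B" "d \<in> pts B" "snd B c = snd B d"
    by (simp_all add: B_def)
  show "ract (fst (gobj G)) (gadd G a b) (gadd G c d) =
      gadd G (ract (fst (gobj G)) a c) (ract (fst (gobj G)) b d)"
    using Over_homD(4)[OF m P_obj[OF B B] pair_point(1)[OF B B ab] pair_point(1)[OF B B cd]]
      pair_point_ract[OF B B ab cd]
    by (simp add: gadd_def B_def)
qed

subsection \<open>Homomorphisms are the additive maps\<close>

text \<open>
  On each fibre an additive map is a homomorphism of groups, so it preserves zeros and inverses.
\<close>
lemma is_group_object_hom_iff:
  assumes G: "is_ab_group_object Over G" and H: "is_ab_group_object Over H"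
  shows "is_group_object_hom Over G H f \<longleftrightarrow> f \<in> Hom Over (gobj G) (gobj H) \<and>
    (\<forall>a\<in>pts (gobj G). \<forall>b\<in>pts (gobj G). snd (gobj G) a = snd (gobj G) b \<longrightarrow>
      f (gadd G a b) = gadd H (f a) (f b))"
proof (cases "f \<in> Hom Over (gobj G) (gobj H)")
  case True
  interpret G: fibrewise_ab_group X "gobj G" "gadd G" "gzero G"
    by (rule fibrewise_ab_group_of_group_object[OF G])
  interpret H: fibrewise_ab_group X "gobj H" "gadd H" "gzero H"
    by (rule fibrewise_ab_group_of_group_object[OF H])
  define A B where "A = gobj G" and "B = gobj H"
  have f: "f \<in> Hom Over A B" using True by (simp add: A_def B_def)
  have A: "A \<in> Obj Over" and B: "B \<in> Obj Over"
    using G.total_obj H.total_obj by (auto simp: A_def B_def)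
  note PA = P_obj[OF A A] and objD = Over_objD[OF A] and fD = Over_homD[OF f A]
  have eG: "gone G \<in> Hom Over T A" and iG: "ginv G \<in> Hom Over A A"
    and eH: "gone H \<in> Hom Over T B" and iH: "ginv H \<in> Hom Over B B"
    using G H by (auto simp: is_ab_group_object_iff A_def B_def)
  note comp = category.comp_in_hom[OF category_Over PA A B _ f]
  let ?f1 = "Comp Over (P A A) A B f (\<pi>1 A A)" and ?f2 = "Comp Over (P A A) A B f (\<pi>2 A A)"
  have pairing_f: "pairing Over (P A A) B B ?f1 ?f2 (pair_point A A a b) = pair_point B B (f a) (f b)"
    if "a \<in> pts A" "b \<in> pts A" "snd A a = snd A b" for a b
    using pairing_eq[OF PA B B comp[OF proj1_hom[OF A A]] comp[OF proj2_hom[OF A A]]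
        pair_point(1)[OF A A that]] pair_point[OF A A that]
    by (simp add: Comp_Over compose_eq)
  have mul_iff: "Comp Over (P A A) A B f (gmul G) =
      Comp Over (P A A) (P B B) B (gmul H) (pairing Over (P A A) B B ?f1 ?f2) \<longleftrightarrow>
    (\<forall>a\<in>pts A. \<forall>b\<in>pts A. snd A a = snd A b \<longrightarrow> f (gadd G a b) = gadd H (f a) (f b))"
    (is "_ \<longleftrightarrow> ?additive")
    unfolding Comp_Over[of "P A A" A B f "gmul G"] Comp_Over[of "P A A" "P B B"] compose_eq_iff
      ball_P_iff[OF A A]
    by (simp add: pairing_f gadd_def A_def[symmetric] B_def[symmetric] cong: ball_cong)
  have "Comp Over T A B f (gone G) = gone H" if ?additive
    unfolding Comp_Over compose_eq_extensional_iff[OF Over_homD(1)[OF eH T_obj]]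
  proof
    fix t assume t: "t \<in> pts T"
    define x where "x = snd T t"
    have x: "x \<in> carrier X" using Over_objD(2)[OF T_obj t] by (simp add: x_def)
    have z: "gzero G x \<in> pts A" "snd A (gzero G x) = x"
      using G.zero_point[OF x] by (simp_all add: A_def)
    have "gadd H (f (gzero G x)) (f (gzero G x)) = f (gzero G x)"
      using that z G.add_zero(1)[of "gzero G x"] by (metis A_def)
    then have "f (gzero G x) = gzero H x"
      using H.add_idem_zero[of "f (gzero G x)"] fD(2,3)[OF z(1)] z by (simp add: B_def)
    then show "f (gone G t) = gone H t"
      by (simp add: gzero_def x_def T_point_snd[OF t])
  qed
  moreover have "Comp Over A A B f (ginv G) = Comp Over A B B (ginv H) f"
    if ?additive and one: "Comp Over T A B f (gone G) = gone H"
    unfolding Comp_Over compose_eq_iff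
  proof
    fix a assume a: "a \<in> pts A"
    define x where "x = snd A a"
    have x: "x \<in> carrier X" using objD(2)[OF a] by (simp add: x_def)
    note ia = Over_homD(2,3)[OF iG A a] and fa = fD(2,3)[OF a]
    note ifa = Over_homD(2,3)[OF iH B fa(1)] and fia = fD(2,3)[OF ia(1)]
    have "gadd G (ginv G a) a = gzero G x" "gadd H (ginv H (f a)) (f a) = gzero H (snd B (f a))"
      using G H a fa unfolding is_ab_group_object_iff by (auto simp: A_def B_def x_def)
    moreover have "f (gzero G x) = gzero H x"
      using one T_point(1)[OF x] by (auto simp: gzero_def Comp_Over compose_eq fun_eq_iff dest: spec[of _ "T_point x"])
    ultimately have "gadd H (f (ginv G a)) (f a) = gzero H x"
      and inverse_H: "gadd H (ginv H (f a)) (f a) = gzero H x"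
      using bspec[OF bspec[OF that(1) ia(1)] a] ia a fa by (auto simp: x_def)
    then have "inv\<^bsub>H.fibre x\<^esub> (f a) = f (ginv G a)"
      by (intro group.inv_equality[OF H.fibre_group_group[OF x]])
        (use ia fa fia in \<open>simp_all add: fibre_group_def B_def[symmetric] x_def\<close>)
    moreover have "inv\<^bsub>H.fibre x\<^esub> (f a) = ginv H (f a)"
      by (intro group.inv_equality[OF H.fibre_group_group[OF x]])
        (use inverse_H fa ifa in \<open>simp_all add: fibre_group_def B_def[symmetric] x_def\<close>)
    ultimately show "f (ginv G a) = ginv H (f a)" by simp
  qed
  ultimately show ?thesis
    using f mul_iff unfolding is_group_object_hom_def Let_def A_def[symmetric] B_def[symmetric]
    by blast
next
  case False
  then show ?thesis by (simp add: is_group_object_hom_def Let_def)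
qed

lemma group_object_hom_zero:
  assumes "is_ab_group_object Over G" "is_ab_group_object Over H" "is_group_object_hom Over G H f"
    and "x \<in> carrier X"
  shows "f (gzero G x) = gzero H x"
proof -
  have "compose (pts T) f (gone G) = gone H"
    using assms(3) by (simp add: is_group_object_hom_def Let_def Comp_Over)
  then have "f (gone G (T_point x)) = gone H (T_point x)"
    using T_point(1)[OF assms(4)] by (metis compose_eq)
  then show ?thesis by (simp add: gzero_def)
qed

lemma category_Ab: "category (Ab Over)"
proof -
  interpret O: category Over by (rule category_Over)
  have obj: "gobj G \<in> Obj Over" if "is_ab_group_object Over G" for G
    using that by (simp add: is_ab_group_object_iff)
  show ?thesis
  proof
    fix G assume "G \<in> Obj (Ab Over)"
    then have G: "is_ab_group_object Over G" by (simp add: Ab_def)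
    interpret G: fibrewise_ab_group X "gobj G" "gadd G" "gzero G"
      by (rule fibrewise_ab_group_of_group_object[OF G])
    have "is_group_object_hom Over G G (Ident Over (gobj G))"
      unfolding is_group_object_hom_iff[OF G G]
      using O.ident_in_hom[OF obj[OF G]] G.add_point by (simp add: Ident_Over)
    then show "Ident (Ab Over) G \<in> Hom (Ab Over) G G" by (simp add: Ab_def)
  next
    fix G H K f g
    assume "G \<in> Obj (Ab Over)" "H \<in> Obj (Ab Over)" "K \<in> Obj (Ab Over)"
      "f \<in> Hom (Ab Over) G H" "g \<in> Hom (Ab Over) H K"
    then have G: "is_ab_group_object Over G" and H: "is_ab_group_object Over H"
      and K: "is_ab_group_object Over K" and f: "is_group_object_hom Over G H f"
      and g: "is_group_object_hom Over H K g" by (auto simp: Ab_def)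
    interpret G: fibrewise_ab_group X "gobj G" "gadd G" "gzero G"
      by (rule fibrewise_ab_group_of_group_object[OF G])
    note f = f[unfolded is_group_object_hom_iff[OF G H]]
      and g = g[unfolded is_group_object_hom_iff[OF H K]]
    note fD = Over_homD[OF conjunct1[OF f] obj[OF G]]
    have "is_group_object_hom Over G K (Comp Over (gobj G) (gobj H) (gobj K) g f)"
      unfolding is_group_object_hom_iff[OF G K]
      using O.comp_in_hom[OF obj[OF G] obj[OF H] obj[OF K] conjunct1[OF f] conjunct1[OF g]]
        f g fD(2,3) G.add_point by (simp add: Comp_Over compose_eq)
    then show "Comp (Ab Over) G H K g f \<in> Hom (Ab Over) G K" by (simp add: Ab_def)
  next
    fix G H f assume "G \<in> Obj (Ab Over)" "H \<in> Obj (Ab Over)" "f \<in> Hom (Ab Over) G H"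
    then have "gobj G \<in> Obj Over" "gobj H \<in> Obj Over" "f \<in> Hom Over (gobj G) (gobj H)"
      using obj by (auto simp: Ab_def is_group_object_hom_def Let_def)
    then show "Comp (Ab Over) G H H (Ident (Ab Over) H) f = f"
      "Comp (Ab Over) G G H f (Ident (Ab Over) G) = f"
      by (simp_all add: Ab_def O.comp_ident_left O.comp_ident_right)
  next
    fix G H K L f g h
    assume "G \<in> Obj (Ab Over)" "H \<in> Obj (Ab Over)" "K \<in> Obj (Ab Over)" "L \<in> Obj (Ab Over)"
      "f \<in> Hom (Ab Over) G H" "g \<in> Hom (Ab Over) H K" "h \<in> Hom (Ab Over) K L"
    then have "gobj G \<in> Obj Over" "gobj H \<in> Obj Over" "gobj K \<in> Obj Over" "gobj L \<in> Obj Over"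
      "f \<in> Hom Over (gobj G) (gobj H)" "g \<in> Hom Over (gobj H) (gobj K)" "h \<in> Hom Over (gobj K) (gobj L)"
      using obj by (auto simp: Ab_def is_group_object_hom_def Let_def)
    then show "Comp (Ab Over) G H L (Comp (Ab Over) H K L h g) f =
        Comp (Ab Over) G K L h (Comp (Ab Over) G H K g f)"
      by (simp add: Ab_def O.comp_assoc)
  qed
qed

end

section \<open>The category of rack modules\<close>

lemma rmodule_homD:
  assumes "f \<in> rmodule_hom X A B"
  shows "f \<in> extensional (carrier X)"
    and "x \<in> carrier X \<Longrightarrow> f x \<in> hom (fib A x) (fib B x)"
    and "x \<in> carrier X \<Longrightarrow> f x \<in> extensional (carrier (fib A x))"
    and "\<lbrakk>x \<in> carrier X; a \<in> carrier (fib A x)\<rbrakk> \<Longrightarrow> f x a \<in> carrier (fib B x)"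
    and "\<lbrakk>x \<in> carrier X; a \<in> carrier (fib A x); b \<in> carrier (fib A x)\<rbrakk>
      \<Longrightarrow> f x (a \<otimes>\<^bsub>fib A x\<^esub> b) = f x a \<otimes>\<^bsub>fib B x\<^esub> f x b"
    and "\<lbrakk>x \<in> carrier X; y \<in> carrier X; a \<in> carrier (fib A x)\<rbrakk>
      \<Longrightarrow> phi B x y (f x a) = f (ract X x y) (phi A x y a)"
    and "\<lbrakk>x \<in> carrier X; y \<in> carrier X; a \<in> carrier (fib A y)\<rbrakk>
      \<Longrightarrow> psi B y x (f y a) = f (ract X x y) (psi A y x a)"
  using assms by (auto simp: rmodule_hom_def PiE_def Pi_def hom_def)

lemma rmodule_homI:
  assumes "f \<in> extensional (carrier X)"
    and "\<And>x. x \<in> carrier X \<Longrightarrow> f x \<in> extensional (carrier (fib A x))"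
    and "\<And>x a. \<lbrakk>x \<in> carrier X; a \<in> carrier (fib A x)\<rbrakk> \<Longrightarrow> f x a \<in> carrier (fib B x)"
    and "\<And>x a b. \<lbrakk>x \<in> carrier X; a \<in> carrier (fib A x); b \<in> carrier (fib A x)\<rbrakk>
      \<Longrightarrow> f x (a \<otimes>\<^bsub>fib A x\<^esub> b) = f x a \<otimes>\<^bsub>fib B x\<^esub> f x b"
    and "\<And>x y a. \<lbrakk>x \<in> carrier X; y \<in> carrier X; a \<in> carrier (fib A x)\<rbrakk>
      \<Longrightarrow> phi B x y (f x a) = f (ract X x y) (phi A x y a)"
    and "\<And>x y a. \<lbrakk>x \<in> carrier X; y \<in> carrier X; a \<in> carrier (fib A y)\<rbrakk>
      \<Longrightarrow> psi B y x (f y a) = f (ract X x y) (psi A y x a)"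
  shows "f \<in> rmodule_hom X A B"
  using assms by (auto simp: rmodule_hom_def PiE_def Pi_def hom_def)

lemma rmodule_hom_eqI:
  assumes f: "f \<in> rmodule_hom X A B" and g: "g \<in> rmodule_hom X A C"
    and "\<And>x a. \<lbrakk>x \<in> carrier X; a \<in> carrier (fib A x)\<rbrakk> \<Longrightarrow> f x a = g x a"
  shows "f = g"
proof (rule extensionalityI[OF rmodule_homD(1)[OF f] rmodule_homD(1)[OF g]])
  fix x assume x: "x \<in> carrier X"
  show "f x = g x"
    using rmodule_homD(3)[OF f x] rmodule_homD(3)[OF g x] assms(3)[OF x]
    by (rule extensionalityI)
qed

context rack_module
begin

lemma fib_group: "x \<in> carrier X \<Longrightarrow> group (fib A x)"
  using fib_comm_group by (simp add: comm_group_def)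

lemma phi_closed: "\<lbrakk>x \<in> carrier X; y \<in> carrier X; a \<in> carrier (fib A x)\<rbrakk>
    \<Longrightarrow> phi A x y a \<in> carrier (fib A (ract X x y))"
  using phi_iso[of x y] by (auto simp: iso_def hom_def)

lemma phi_mult: "\<lbrakk>x \<in> carrier X; y \<in> carrier X; a \<in> carrier (fib A x); b \<in> carrier (fib A x)\<rbrakk>
    \<Longrightarrow> phi A x y (a \<otimes>\<^bsub>fib A x\<^esub> b) = phi A x y a \<otimes>\<^bsub>fib A (ract X x y)\<^esub> phi A x y b"
  using phi_iso[of x y] by (auto simp: iso_def hom_def)

lemma psi_closed: "\<lbrakk>x \<in> carrier X; y \<in> carrier X; a \<in> carrier (fib A y)\<rbrakk>
    \<Longrightarrow> psi A y x a \<in> carrier (fib A (ract X x y))"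
  using psi_hom[of x y] by (auto simp: hom_def)

lemma psi_mult: "\<lbrakk>x \<in> carrier X; y \<in> carrier X; a \<in> carrier (fib A y); b \<in> carrier (fib A y)\<rbrakk>
    \<Longrightarrow> psi A y x (a \<otimes>\<^bsub>fib A y\<^esub> b) = psi A y x a \<otimes>\<^bsub>fib A (ract X x y)\<^esub> psi A y x b"
  using psi_hom[of x y] by (auto simp: hom_def)

lemma phi_one: "\<lbrakk>x \<in> carrier X; y \<in> carrier X\<rbrakk>
    \<Longrightarrow> phi A x y \<one>\<^bsub>fib A x\<^esub> = \<one>\<^bsub>fib A (ract X x y)\<^esub>"
  using phi_iso[of x y] hom_one[of "phi A x y" "fib A x"] fib_group ract_closed
  by (auto simp: iso_def)

lemma psi_one: "\<lbrakk>x \<in> carrier X; y \<in> carrier X\<rbrakk>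
    \<Longrightarrow> psi A y x \<one>\<^bsub>fib A y\<^esub> = \<one>\<^bsub>fib A (ract X x y)\<^esub>"
  using psi_hom[of x y] hom_one[of "psi A y x" "fib A y"] fib_group ract_closed by auto

end

lemma category_RMod:
  assumes "rack X"
  shows "category (RMod X)"
proof -
  interpret rack X by (rule assms)
  have comp: "Comp (RMod X) A B D g f \<in> rmodule_hom X A D"
    if "rack_module X A" "f \<in> rmodule_hom X A B" "g \<in> rmodule_hom X B D" for A B D f g
  proof -
    interpret A: rack_module X A by (rule that)
    note f = rmodule_homD[OF that(2)] and g = rmodule_homD[OF that(3)]
    show ?thesis
      using f g A.fib_group
      by (intro rmodule_homI)
        (auto simp: RMod_def compose_eq A.phi_closed A.psi_closed ract_closed
          group.is_monoid monoid.m_closed)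
  qed
  have comp_eq: "Comp (RMod X) A B D g f x a = g x (f x a)"
    if "x \<in> carrier X" "a \<in> carrier (fib A x)" for A B D f g x a
    using that by (simp add: RMod_def compose_eq)
  have ident: "Ident (RMod X) A \<in> rmodule_hom X A A" if "rack_module X A" for A
  proof -
    interpret A: rack_module X A by (rule that)
    show ?thesis
      using A.fib_group
      by (intro rmodule_homI)
        (auto simp: RMod_def A.phi_closed A.psi_closed ract_closed
          group.is_monoid monoid.m_closed)
  qed
  show ?thesis
  proof
    fix A assume "A \<in> Obj (RMod X)"
    then show "Ident (RMod X) A \<in> Hom (RMod X) A A"
      using ident by (simp add: RMod_def)
  next
    fix A B D f g
    assume "A \<in> Obj (RMod X)" "f \<in> Hom (RMod X) A B" "g \<in> Hom (RMod X) B D"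
    then show "Comp (RMod X) A B D g f \<in> Hom (RMod X) A D"
      using comp[of A f B g D] by (simp add: RMod_def)
  next
    fix A B f assume "A \<in> Obj (RMod X)" "B \<in> Obj (RMod X)" "f \<in> Hom (RMod X) A B"
    then have A: "rack_module X A" and B: "rack_module X B" and f: "f \<in> rmodule_hom X A B"
      by (auto simp: RMod_def)
    show "Comp (RMod X) A B B (Ident (RMod X) B) f = f"
      by (rule rmodule_hom_eqI[OF comp[OF A f ident[OF B]] f])
        (use rmodule_homD(4)[OF f] in \<open>simp add: comp_eq, simp add: RMod_def\<close>)
    show "Comp (RMod X) A A B f (Ident (RMod X) A) = f"
      by (rule rmodule_hom_eqI[OF comp[OF A ident[OF A] f] f])
        (simp add: comp_eq, simp add: RMod_def)
  next
    fix A B D E f g h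
    assume "A \<in> Obj (RMod X)" "B \<in> Obj (RMod X)" "f \<in> Hom (RMod X) A B"
      "g \<in> Hom (RMod X) B D" "h \<in> Hom (RMod X) D E"
    then have A: "rack_module X A" and B: "rack_module X B" and f: "f \<in> rmodule_hom X A B"
      and g: "g \<in> rmodule_hom X B D" and h: "h \<in> rmodule_hom X D E"
      by (auto simp: RMod_def)
    show "Comp (RMod X) A B E (Comp (RMod X) B D E h g) f =
        Comp (RMod X) A D E h (Comp (RMod X) A B D g f)"
      by (rule rmodule_hom_eqI[OF comp[OF A f comp[OF B g h]] comp[OF A comp[OF A f g] h]])
        (simp add: comp_eq rmodule_homD(4)[OF f])
  qed
qed

section \<open>The total space of a module\<close>

context rack_in_infinite_universe
begin

definition total_pairs :: "'u rmodule \<Rightarrow> ('u \<times> 'u) set" where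
  "total_pairs A = (SIGMA x : carrier X. carrier (fib A x))"

definition total_op :: "'u rmodule \<Rightarrow> 'u \<times> 'u \<Rightarrow> 'u \<times> 'u \<Rightarrow> 'u \<times> 'u" where
  "total_op A u v = (ract X (fst u) (fst v),
     phi A (fst u) (fst v) (snd u) \<otimes>\<^bsub>fib A (ract X (fst u) (fst v))\<^esub> psi A (fst v) (fst u) (snd v))"

definition total :: "'u rmodule \<Rightarrow> 'u rack \<times> ('u \<Rightarrow> 'u)" where
  "total A = (encoded_rack (total_pairs A) (total_op A),
     \<lambda>u\<in>encode ` total_pairs A. fst (decode u))"

definition total_add :: "'u rmodule \<Rightarrow> 'u \<Rightarrow> 'u \<Rightarrow> 'u" where
  "total_add A u v =
     encode (fst (decode u), snd (decode u) \<otimes>\<^bsub>fib A (fst (decode u))\<^esub> snd (decode v))"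

definition total_zero :: "'u rmodule \<Rightarrow> 'u \<Rightarrow> 'u" where
  "total_zero A x = encode (x, \<one>\<^bsub>fib A x\<^esub>)"

lemma total_ptsE:
  assumes "u \<in> pts (total A)"
  obtains x a where "u = encode (x, a)" "x \<in> carrier X" "a \<in> carrier (fib A x)"
  using assms by (auto simp: total_def encoded_rack_def total_pairs_def)

lemma encode_total_iff [simp]:
  "encode (x, a) \<in> pts (total A) \<longleftrightarrow> x \<in> carrier X \<and> a \<in> carrier (fib A x)"
  by (auto simp: total_def encoded_rack_def total_pairs_def)

lemma total_proj [simp]:
  "\<lbrakk>x \<in> carrier X; a \<in> carrier (fib A x)\<rbrakk> \<Longrightarrow> snd (total A) (encode (x, a)) = x"
  by (auto simp: total_def total_pairs_def)

lemma total_ract [simp]: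
  "ract (fst (total A)) (encode (x, a)) (encode (y, b)) =
     encode (ract X x y, phi A x y a \<otimes>\<^bsub>fib A (ract X x y)\<^esub> psi A y x b)"
  by (simp add: total_def encoded_rack_def total_op_def)

lemma total_add_encode [simp]:
  "total_add A (encode (x, a)) (encode (y, b)) = encode (x, a \<otimes>\<^bsub>fib A x\<^esub> b)"
  by (simp add: total_add_def)

text \<open>
  Division in the total space solves for \<open>a\<close> in \<open>\<phi>(a) + \<psi>(b) = c\<close>, which is possible because \<open>\<phi>\<close>
  is invertible. In the self-distributive law the contributions of the first, second and third
  argument agree by \<open>phi_phi\<close>, \<open>phi_psi\<close> and \<open>psi_add\<close> respectively.
\<close>
lemma rack_total:
  assumes "rack_module X A"
  shows "rack (fst (total A))"
proof -
  interpret A: rack_module X A by (rule assms)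
  have closed: "total_op A u v \<in> total_pairs A" if "u \<in> total_pairs A" "v \<in> total_pairs A" for u v
  proof -
    have xy: "fst u \<in> carrier X" "fst v \<in> carrier X" "snd u \<in> carrier (fib A (fst u))"
      "snd v \<in> carrier (fib A (fst v))" using that by (auto simp: total_pairs_def)
    interpret comm_group "fib A (ract X (fst u) (fst v))"
      using xy by (intro A.fib_comm_group ract_closed)
    show ?thesis
      using xy by (simp add: total_op_def total_pairs_def ract_closed A.phi_closed A.psi_closed)
  qed
  have "rack (encoded_rack (total_pairs A) (total_op A))"
  proof (rule rack_encoded_rack)
    show "infinite (UNIV :: 'u set)" by (rule infinite_universe)
  next
    fix u v assume "u \<in> total_pairs A" "v \<in> total_pairs A"
    then show "total_op A u v \<in> total_pairs A" by (rule closed)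
  next
    fix u v assume "u \<in> total_pairs A" "v \<in> total_pairs A"
    then obtain x a y b where u: "u = (x, a)" "x \<in> carrier X" "a \<in> carrier (fib A x)"
      and v: "v = (y, b)" "y \<in> carrier X" "b \<in> carrier (fib A y)"
      by (auto simp: total_pairs_def)
    obtain z where z: "z \<in> carrier X" "ract X z y = x"
      using ex1_implies_ex[OF ract_unique[OF u(2) v(2)]] by blast
    interpret comm_group "fib A x" by (rule A.fib_comm_group[OF u(2)])
    have psi: "psi A y z b \<in> carrier (fib A x)" using A.psi_closed[OF z(1) v(2,3)] z by simp
    have "phi A z y ` carrier (fib A z) = carrier (fib A x)"
      using A.phi_iso[OF z(1) v(2)] z by (simp add: iso_def bij_betw_def)
    then obtain c where c: "c \<in> carrier (fib A z)" "phi A z y c = a \<otimes>\<^bsub>fib A x\<^esub> inv\<^bsub>fib A x\<^esub> psi A y z b"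
      using u(3) psi by (metis imageE inv_closed m_closed)
    have "phi A z y c \<otimes>\<^bsub>fib A x\<^esub> psi A y z b = a"
      using u(3) psi by (simp add: c m_assoc)
    then show "\<exists>w\<in>total_pairs A. total_op A w v = u"
      using z c u v by (intro bexI[of _ "(z, c)"]) (simp_all add: total_op_def total_pairs_def)
  next
    fix u v w assume uvw: "u \<in> total_pairs A" "v \<in> total_pairs A" "w \<in> total_pairs A"
      and eq: "total_op A u w = total_op A v w"
    obtain x a where u: "u = (x, a)" "x \<in> carrier X" "a \<in> carrier (fib A x)"
      using uvw by (auto simp: total_pairs_def)
    obtain y b where v: "v = (y, b)" "y \<in> carrier X" "b \<in> carrier (fib A y)"
      using uvw by (auto simp: total_pairs_def)
    obtain z c where w: "w = (z, c)" "z \<in> carrier X" "c \<in> carrier (fib A z)"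
      using uvw by (auto simp: total_pairs_def)
    have xy: "x = y"
      using eq ract_right_cancel[OF u(2) v(2) w(2)] by (simp add: total_op_def u v w)
    interpret comm_group "fib A (ract X x z)"
      by (intro A.fib_comm_group ract_closed u w)
    have b: "b \<in> carrier (fib A x)" using v xy by simp
    have "phi A x z a \<otimes>\<^bsub>fib A (ract X x z)\<^esub> psi A z x c = phi A x z b \<otimes>\<^bsub>fib A (ract X x z)\<^esub> psi A z x c"
      using eq by (simp add: total_op_def u v w xy)
    then have "phi A x z a = phi A x z b"
      using A.phi_closed[OF u(2) w(2) u(3)] A.phi_closed[OF u(2) w(2) b] A.psi_closed[OF u(2) w(2,3)]
      by simp
    moreover have "inj_on (phi A x z) (carrier (fib A x))"
      using A.phi_iso[OF u(2) w(2)] by (simp add: iso_def bij_betw_def)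
    ultimately show "u = v"
      using u v b xy by (auto dest: inj_onD)
  next
    fix u v w assume uvw: "u \<in> total_pairs A" "v \<in> total_pairs A" "w \<in> total_pairs A"
    obtain x a where u: "u = (x, a)" and x: "x \<in> carrier X" and a: "a \<in> carrier (fib A x)"
      using uvw by (auto simp: total_pairs_def)
    obtain y b where v: "v = (y, b)" and y: "y \<in> carrier X" and b: "b \<in> carrier (fib A y)"
      using uvw by (auto simp: total_pairs_def)
    obtain z c where w: "w = (z, c)" and z: "z \<in> carrier X" and c: "c \<in> carrier (fib A z)"
      using uvw by (auto simp: total_pairs_def)
    note r = ract_closed
    let ?xy = "ract X x y" and ?xz = "ract X x z" and ?yz = "ract X y z"
    let ?H = "fib A (ract X ?xz ?yz)"
    have xyz: "ract X ?xy z = ract X ?xz ?yz" by (rule ract_distrib[OF x y z])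
    interpret comm_group ?H by (intro A.fib_comm_group r x y z)
    have 1: "phi A ?xy z (phi A x y a \<otimes>\<^bsub>fib A ?xy\<^esub> psi A y x b) =
        phi A ?xz ?yz (phi A x z a) \<otimes>\<^bsub>?H\<^esub> psi A ?yz ?xz (phi A y z b)"
      using A.phi_mult[OF r[OF x y] z A.phi_closed[OF x y a] A.psi_closed[OF x y b]]
        A.phi_phi[OF x y z a] A.phi_psi[OF x y z b] by (simp add: xyz)
    have 2: "psi A z ?xy c =
        phi A ?xz ?yz (psi A z x c) \<otimes>\<^bsub>?H\<^esub> psi A ?yz ?xz (psi A z y c)"
      using A.psi_add[OF x y z c] by (simp add: xyz)
    have 3: "phi A ?xz ?yz (phi A x z a \<otimes>\<^bsub>fib A ?xz\<^esub> psi A z x c) =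
        phi A ?xz ?yz (phi A x z a) \<otimes>\<^bsub>?H\<^esub> phi A ?xz ?yz (psi A z x c)"
      by (rule A.phi_mult[OF r[OF x z] r[OF y z] A.phi_closed[OF x z a] A.psi_closed[OF x z c]])
    have 4: "psi A ?yz ?xz (phi A y z b \<otimes>\<^bsub>fib A ?yz\<^esub> psi A z y c) =
        psi A ?yz ?xz (phi A y z b) \<otimes>\<^bsub>?H\<^esub> psi A ?yz ?xz (psi A z y c)"
      by (rule A.psi_mult[OF r[OF x z] r[OF y z] A.phi_closed[OF y z b] A.psi_closed[OF y z c]])
    note cl = A.phi_closed[OF r[OF x z] r[OF y z] A.phi_closed[OF x z a]]
      A.phi_closed[OF r[OF x z] r[OF y z] A.psi_closed[OF x z c]]
      A.psi_closed[OF r[OF x z] r[OF y z] A.phi_closed[OF y z b]]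
      A.psi_closed[OF r[OF x z] r[OF y z] A.psi_closed[OF y z c]]
    have "phi A ?xy z (phi A x y a \<otimes>\<^bsub>fib A ?xy\<^esub> psi A y x b) \<otimes>\<^bsub>?H\<^esub> psi A z ?xy c =
      phi A ?xz ?yz (phi A x z a \<otimes>\<^bsub>fib A ?xz\<^esub> psi A z x c) \<otimes>\<^bsub>?H\<^esub>
      psi A ?yz ?xz (phi A y z b \<otimes>\<^bsub>fib A ?yz\<^esub> psi A z y c)"
      unfolding 1 2 3 4 using cl by (simp add: m_ac)
    then show "total_op A (total_op A u v) w = total_op A (total_op A u w) (total_op A v w)"
      by (simp add: total_op_def u v w xyz)
  qed
  then show ?thesis by (simp add: total_def)
qed

lemma total_obj:
  assumes "rack_module X A"
  shows "total A \<in> Obj Over"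
proof -
  interpret A: rack_module X A by (rule assms)
  interpret R: rack "fst (total A)" by (rule rack_total[OF assms])
  have "snd (total A) \<in> rack_hom (fst (total A)) X"
  proof (rule rack_homI)
    show "snd (total A) \<in> extensional (pts (total A))"
      by (simp add: total_def encoded_rack_def)
    fix u assume u: "u \<in> pts (total A)"
    then show "snd (total A) u \<in> carrier X" by (auto elim: total_ptsE)
    fix v assume v: "v \<in> pts (total A)"
    show "snd (total A) (ract (fst (total A)) u v) = ract X (snd (total A) u) (snd (total A) v)"
      using R.ract_closed[OF u v] u v by (auto elim!: total_ptsE)
  qed
  then show ?thesis using rack_total[OF assms] by (simp add: Obj_Over)
qed

text \<open>
  The fibre over \<open>x\<close> is a copy of \<open>fib A x\<close>. Addition respects the operation because \<open>\<phi>\<close> and \<open>\<psi>\<close>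
  are additive and the fibres are commutative.
\<close>
lemma fibrewise_ab_group_total:
  assumes "rack_module X A"
  shows "fibrewise_ab_group X (total A) (total_add A) (total_zero A)"
proof (intro fibrewise_ab_group.intro fibrewise_ab_group_axioms.intro)
  interpret A: rack_module X A by (rule assms)
  show "rack_in_infinite_universe X" ..
  show "total A \<in> Obj Over" by (rule total_obj[OF assms])
  fix x assume x: "x \<in> carrier X"
  interpret comm_group "fib A x" by (rule A.fib_comm_group[OF x])
  have carrier: "carrier (fibre_group (total A) (total_add A) (total_zero A) x) =
      (\<lambda>a. encode (x, a)) ` carrier (fib A x)"
    using x by (auto simp: fibre_group_def elim!: total_ptsE)
  have mult: "encode (x, a) \<otimes>\<^bsub>fibre_group (total A) (total_add A) (total_zero A) x\<^esub> encode (x, b) =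
      encode (x, a \<otimes>\<^bsub>fib A x\<^esub> b)" for a b
    by (simp add: fibre_group_def)
  have one: "\<one>\<^bsub>fibre_group (total A) (total_add A) (total_zero A) x\<^esub> = encode (x, \<one>\<^bsub>fib A x\<^esub>)"
    by (simp add: fibre_group_def total_zero_def)
  show "comm_group (fibre_group (total A) (total_add A) (total_zero A) x)"
  proof (rule comm_groupI)
    fix u assume "u \<in> carrier (fibre_group (total A) (total_add A) (total_zero A) x)"
    then obtain a where "u = encode (x, a)" "a \<in> carrier (fib A x)" by (auto simp: carrier)
    then show "\<exists>v\<in>carrier (fibre_group (total A) (total_add A) (total_zero A) x).
        v \<otimes>\<^bsub>fibre_group (total A) (total_add A) (total_zero A) x\<^esub> u =
        \<one>\<^bsub>fibre_group (total A) (total_add A) (total_zero A) x\<^esub>"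
      by (intro bexI[of _ "encode (x, inv\<^bsub>fib A x\<^esub> a)"]) (simp_all add: mult one carrier)
  qed (auto simp: carrier mult one m_ac)
next
  interpret A: rack_module X A by (rule assms)
  fix a b c d
  assume "a \<in> pts (total A)" "b \<in> pts (total A)" "c \<in> pts (total A)" "d \<in> pts (total A)"
    and "snd (total A) a = snd (total A) b" "snd (total A) c = snd (total A) d"
  then obtain x a' b' y c' d' where x: "x \<in> carrier X" "a' \<in> carrier (fib A x)" "b' \<in> carrier (fib A x)"
    and y: "y \<in> carrier X" "c' \<in> carrier (fib A y)" "d' \<in> carrier (fib A y)"
    and eq: "a = encode (x, a')" "b = encode (x, b')" "c = encode (y, c')" "d = encode (y, d')"
    by (auto elim!: total_ptsE)
  interpret comm_group "fib A (ract X x y)" by (intro A.fib_comm_group ract_closed x y)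
  note cl = A.phi_closed[OF x(1) y(1) x(2)] A.phi_closed[OF x(1) y(1) x(3)]
    A.psi_closed[OF x(1) y(1,2)] A.psi_closed[OF x(1) y(1,3)]
  show "ract (fst (total A)) (total_add A a b) (total_add A c d) =
      total_add A (ract (fst (total A)) a c) (ract (fst (total A)) b d)"
    using cl by (simp add: eq A.phi_mult[OF x(1) y(1) x(2,3)] A.psi_mult[OF x(1) y] m_ac)
qed

definition total_object where
  "total_object A = fibrewise_ab_group.group_object X (total A) (total_add A) (total_zero A)"

definition total_map :: "'u rmodule \<Rightarrow> ('u \<Rightarrow> 'u \<Rightarrow> 'u) \<Rightarrow> 'u \<Rightarrow> 'u" where
  "total_map A f = (\<lambda>u\<in>pts (total A). encode (fst (decode u), f (fst (decode u)) (snd (decode u))))"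

lemma total_map_encode [simp]:
  "\<lbrakk>x \<in> carrier X; a \<in> carrier (fib A x)\<rbrakk> \<Longrightarrow> total_map A f (encode (x, a)) = encode (x, f x a)"
  by (simp add: total_map_def)

lemma gobj_total_object: "rack_module X A \<Longrightarrow> gobj (total_object A) = total A"
  unfolding total_object_def
  by (rule fibrewise_ab_group.gobj_group_object[OF fibrewise_ab_group_total])

lemma total_object_ab: "rack_module X A \<Longrightarrow> is_ab_group_object Over (total_object A)"
  unfolding total_object_def
  by (rule fibrewise_ab_group.is_ab_group_object_group_object[OF fibrewise_ab_group_total])

lemma gadd_total_object:
  assumes "rack_module X A" "x \<in> carrier X" "a \<in> carrier (fib A x)" "b \<in> carrier (fib A x)"
  shows "gadd (total_object A) (encode (x, a)) (encode (x, b)) = encode (x, a \<otimes>\<^bsub>fib A x\<^esub> b)"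
  using fibrewise_ab_group.gadd_group_object[OF fibrewise_ab_group_total[OF assms(1)],
      of "encode (x, a)" "encode (x, b)"] assms(2-)
  by (simp add: total_object_def)

lemma gzero_total_object:
  assumes "rack_module X A" "x \<in> carrier X"
  shows "gzero (total_object A) x = encode (x, \<one>\<^bsub>fib A x\<^esub>)"
  using fibrewise_ab_group.gzero_group_object[OF fibrewise_ab_group_total[OF assms(1)] assms(2)]
  by (simp add: total_object_def total_zero_def)

lemma total_object_hom_iff:
  assumes A: "rack_module X A" and G: "is_ab_group_object Over G"
  shows "is_group_object_hom Over (total_object A) G h \<longleftrightarrow> h \<in> Hom Over (total A) (gobj G) \<and>
    (\<forall>x\<in>carrier X. \<forall>a\<in>carrier (fib A x). \<forall>b\<in>carrier (fib A x).
      h (encode (x, a \<otimes>\<^bsub>fib A x\<^esub> b)) = gadd G (h (encode (x, a))) (h (encode (x, b))))"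
proof -
  have "(\<forall>u\<in>pts (total A). \<forall>v\<in>pts (total A). snd (total A) u = snd (total A) v \<longrightarrow>
      h (gadd (total_object A) u v) = gadd G (h u) (h v)) \<longleftrightarrow>
    (\<forall>x\<in>carrier X. \<forall>a\<in>carrier (fib A x). \<forall>b\<in>carrier (fib A x).
      h (encode (x, a \<otimes>\<^bsub>fib A x\<^esub> b)) = gadd G (h (encode (x, a))) (h (encode (x, b))))"
    (is "?l = ?r")
  proof
    assume l: ?l
    show ?r
    proof (intro ballI)
      fix x a b assume x: "x \<in> carrier X" "a \<in> carrier (fib A x)" "b \<in> carrier (fib A x)"
      then have "h (gadd (total_object A) (encode (x, a)) (encode (x, b))) =
          gadd G (h (encode (x, a))) (h (encode (x, b)))"
        using l by simp
      then show "h (encode (x, a \<otimes>\<^bsub>fib A x\<^esub> b)) = gadd G (h (encode (x, a))) (h (encode (x, b)))"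
        by (simp add: gadd_total_object[OF A x])
    qed
  next
    assume r: ?r
    show ?l
    proof (intro ballI impI)
      fix u v assume "u \<in> pts (total A)" "v \<in> pts (total A)" "snd (total A) u = snd (total A) v"
      then obtain x a b where x: "x \<in> carrier X" "a \<in> carrier (fib A x)" "b \<in> carrier (fib A x)"
        and uv: "u = encode (x, a)" "v = encode (x, b)"
        by (auto elim!: total_ptsE)
      then show "h (gadd (total_object A) u v) = gadd G (h u) (h v)"
        using r by (simp add: gadd_total_object[OF A x])
    qed
  qed
  then show ?thesis
    unfolding is_group_object_hom_iff[OF total_object_ab[OF A] G] gobj_total_object[OF A] by simp
qed

lemma total_map_hom:
  assumes A: "rack_module X A" and B: "rack_module X B" and f: "f \<in> rmodule_hom X A B"
  shows "is_group_object_hom Over (total_object A) (total_object B) (total_map A f)"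
proof -
  interpret A: rack_module X A by (rule A)
  interpret B: rack_module X B by (rule B)
  note fD = rmodule_homD[OF f]
  have "total_map A f \<in> Hom Over (total A) (total B)"
  proof (rule Over_homI[OF total_obj[OF A]])
    show "total_map A f \<in> extensional (pts (total A))" by (simp add: total_map_def)
    fix u assume "u \<in> pts (total A)"
    then obtain x a where x: "x \<in> carrier X" and a: "a \<in> carrier (fib A x)" and u: "u = encode (x, a)"
      by (auto elim!: total_ptsE)
    show "total_map A f u \<in> pts (total B)" "snd (total B) (total_map A f u) = snd (total A) u"
      using x a u fD(4) by simp_all
    fix v assume "v \<in> pts (total A)"
    then obtain y b where y: "y \<in> carrier X" and b: "b \<in> carrier (fib A y)" and v: "v = encode (y, b)"
      by (auto elim!: total_ptsE)
    note xy = ract_closed[OF x y] and cl = A.phi_closed[OF x y a] A.psi_closed[OF x y b]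
    interpret comm_group "fib A (ract X x y)" by (rule A.fib_comm_group[OF xy])
    show "total_map A f (ract (fst (total A)) u v) =
        ract (fst (total B)) (total_map A f u) (total_map A f v)"
      using x y a b xy cl by (simp add: u v fD(5-7))
  qed
  then show ?thesis
    unfolding total_object_hom_iff[OF A total_object_ab[OF B]] gobj_total_object[OF B]
  proof (intro conjI ballI)
    fix x a b assume x: "x \<in> carrier X" "a \<in> carrier (fib A x)" "b \<in> carrier (fib A x)"
    interpret comm_group "fib A x" by (rule A.fib_comm_group[OF x(1)])
    show "total_map A f (encode (x, a \<otimes>\<^bsub>fib A x\<^esub> b)) =
        gadd (total_object B) (total_map A f (encode (x, a))) (total_map A f (encode (x, b)))"
      using x fD(4) by (simp add: gadd_total_object[OF B] fD(5))
  qed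
qed

text \<open>
  A map over \<open>X\<close> preserves first coordinates, so its second coordinates form a family of maps
  between the fibres.
\<close>
lemma total_map_full:
  assumes A: "rack_module X A" and B: "rack_module X B"
    and h: "is_group_object_hom Over (total_object A) (total_object B) h"
  shows "\<exists>f\<in>rmodule_hom X A B. total_map A f = h"
proof -
  interpret A: rack_module X A by (rule A)
  interpret B: rack_module X B by (rule B)
  have hom: "h \<in> Hom Over (total A) (total B)"
    and add: "\<And>x a b. \<lbrakk>x \<in> carrier X; a \<in> carrier (fib A x); b \<in> carrier (fib A x)\<rbrakk> \<Longrightarrow>
      h (encode (x, a \<otimes>\<^bsub>fib A x\<^esub> b)) = gadd (total_object B) (h (encode (x, a))) (h (encode (x, b)))"
    using h unfolding total_object_hom_iff[OF A total_object_ab[OF B]] gobj_total_object[OF B] by auto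
  note hD = Over_homD[OF hom total_obj[OF A]]
  define f where "f = (\<lambda>x\<in>carrier X. \<lambda>a\<in>carrier (fib A x). snd (decode (h (encode (x, a)))))"
  have f_ext: "f \<in> extensional (carrier X)"
    "\<And>x. x \<in> carrier X \<Longrightarrow> f x \<in> extensional (carrier (fib A x))"
    by (simp_all add: f_def)
  have f: "f x a \<in> carrier (fib B x)" "h (encode (x, a)) = encode (x, f x a)"
    if "x \<in> carrier X" "a \<in> carrier (fib A x)" for x a
  proof -
    have "h (encode (x, a)) \<in> pts (total B)" "snd (total B) (h (encode (x, a))) = x"
      using hD(2,3)[of "encode (x, a)"] that by simp_all
    then obtain b where "h (encode (x, a)) = encode (x, b)" "b \<in> carrier (fib B x)"
      by (auto elim!: total_ptsE)
    then show "f x a \<in> carrier (fib B x)" "h (encode (x, a)) = encode (x, f x a)"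
      using that by (simp_all add: f_def)
  qed
  have one: "f x \<one>\<^bsub>fib A x\<^esub> = \<one>\<^bsub>fib B x\<^esub>" if x: "x \<in> carrier X" for x
  proof -
    interpret comm_group "fib A x" by (rule A.fib_comm_group[OF x])
    show ?thesis
      using group_object_hom_zero[OF total_object_ab[OF A] total_object_ab[OF B] h x] f(2)[OF x one_closed]
      by (simp add: gzero_total_object[OF A x] gzero_total_object[OF B x])
  qed
  have "f \<in> rmodule_hom X A B"
  proof (rule rmodule_homI)
    fix x a b assume x: "x \<in> carrier X" "a \<in> carrier (fib A x)" "b \<in> carrier (fib A x)"
    interpret comm_group "fib A x" by (rule A.fib_comm_group[OF x(1)])
    show "f x (a \<otimes>\<^bsub>fib A x\<^esub> b) = f x a \<otimes>\<^bsub>fib B x\<^esub> f x b"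
      using add[OF x] x by (simp add: f gadd_total_object[OF B])
  next
    \<comment> \<open>Acting by a zero isolates \<open>phi\<close>, and acting on a zero isolates \<open>psi\<close>.\<close>
    fix x y a assume x: "x \<in> carrier X" and y: "y \<in> carrier X" and a: "a \<in> carrier (fib A x)"
    interpret Ax: comm_group "fib A (ract X x y)" by (intro A.fib_comm_group ract_closed x y)
    interpret Bx: comm_group "fib B (ract X x y)" by (intro B.fib_comm_group ract_closed x y)
    interpret Ay: comm_group "fib A y" by (intro A.fib_comm_group y)
    have "h (ract (fst (total A)) (encode (x, a)) (encode (y, \<one>\<^bsub>fib A y\<^esub>))) =
        ract (fst (total B)) (h (encode (x, a))) (h (encode (y, \<one>\<^bsub>fib A y\<^esub>)))"
      using x y a by (intro hD(4)) simp_all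
    then show "phi B x y (f x a) = f (ract X x y) (phi A x y a)"
      using x y a ract_closed[OF x y] A.phi_closed[OF x y a] B.phi_closed[OF x y f(1)[OF x a]]
      by (simp add: A.psi_one B.psi_one f one)
  next
    fix x y a assume x: "x \<in> carrier X" and y: "y \<in> carrier X" and a: "a \<in> carrier (fib A y)"
    interpret Ax: comm_group "fib A (ract X x y)" by (intro A.fib_comm_group ract_closed x y)
    interpret Bx: comm_group "fib B (ract X x y)" by (intro B.fib_comm_group ract_closed x y)
    interpret A0: comm_group "fib A x" by (intro A.fib_comm_group x)
    have "h (ract (fst (total A)) (encode (x, \<one>\<^bsub>fib A x\<^esub>)) (encode (y, a))) =
        ract (fst (total B)) (h (encode (x, \<one>\<^bsub>fib A x\<^esub>))) (h (encode (y, a)))"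
      using x y a by (intro hD(4)) simp_all
    then show "psi B y x (f y a) = f (ract X x y) (psi A y x a)"
      using x y a ract_closed[OF x y] A.psi_closed[OF x y a] B.psi_closed[OF x y f(1)[OF y a]]
      by (simp add: A.phi_one B.phi_one f one)
  qed (use f(1) in \<open>simp_all add: f_ext\<close>)
  moreover have "total_map A f = h"
  proof (rule extensionalityI[of _ "pts (total A)"])
    show "total_map A f u = h u" if "u \<in> pts (total A)" for u
      using that f(2) by (auto elim!: total_ptsE)
  qed (use hD(1) in \<open>simp_all add: total_map_def\<close>)
  ultimately show ?thesis by blast
qed

lemma total_map_faithful:
  assumes f: "f \<in> rmodule_hom X A B" and g: "g \<in> rmodule_hom X A B" and "total_map A f = total_map A g"
  shows "f = g"
proof (rule rmodule_hom_eqI[OF f g])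
  fix x a assume "x \<in> carrier X" "a \<in> carrier (fib A x)"
  then show "f x a = g x a"
    using fun_cong[OF assms(3), of "encode (x, a)"] by simp
qed

lemma is_functor_total:
  "is_functor (RMod X) (Ab Over) \<lparr>obj_map = total_object, arr_map = (\<lambda>A B. total_map A)\<rparr>"
proof -
  have "total_map A (Ident (RMod X) A) = Ident Over (total A)" for A
    unfolding Ident_Over total_map_def by (rule restrict_ext) (auto simp: RMod_def elim!: total_ptsE)
  moreover have "total_map A (Comp (RMod X) A B D g f) = compose (pts (total A)) (total_map B g) (total_map A f)"
    if f: "f \<in> rmodule_hom X A B" for A B D f g
    unfolding total_map_def[of A "Comp (RMod X) A B D g f"] compose_def
    using rmodule_homD(4)[OF f]
    by (intro restrict_ext) (auto simp: RMod_def compose_eq elim!: total_ptsE)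
  ultimately show ?thesis
    unfolding is_functor_def
    by (auto simp: total_object_ab total_map_hom gobj_total_object Comp_Over RMod_def Ab_def)
qed

end

section \<open>The module of a fibrewise Abelian group\<close>

context fibrewise_ab_group
begin

definition fibre_module :: "'u rmodule" where
  "fibre_module = \<lparr>fib = fibre, phi = (\<lambda>x y a. ract (fst B) a (zero y)),
     psi = (\<lambda>y x b. ract (fst B) (zero x) b)\<rparr>"

lemma fibre_module_simps [simp]:
  "fib fibre_module = fibre"
  "phi fibre_module x y a = ract (fst B) a (zero y)"
  "psi fibre_module y x b = ract (fst B) (zero x) b"
  by (simp_all add: fibre_module_def)

lemma carrier_fibre: "a \<in> carrier (fibre x) \<longleftrightarrow> a \<in> pts B \<and> snd B a = x"
  by (simp add: fibre_group_def)

lemma mult_fibre: "a \<otimes>\<^bsub>fibre x\<^esub> b = add a b"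
  by (simp add: fibre_group_def)

text \<open>
  The operation is the sum of its restrictions to the zero section in either argument, since
  \<open>a = a + 0\<close> and \<open>b = 0 + b\<close> are added componentwise.
\<close>
lemma ract_split:
  assumes "a \<in> pts B" "b \<in> pts B"
  shows "ract (fst B) a b =
    add (ract (fst B) a (zero (snd B b))) (ract (fst B) (zero (snd B a)) b)"
proof -
  have "ract (fst B) (add a (zero (snd B a))) (add (zero (snd B b)) b) =
      add (ract (fst B) a (zero (snd B b))) (ract (fst B) (zero (snd B a)) b)"
    using assms zero_point Over_objD(2)[OF total_obj] by (intro add_ract) simp_all
  then show ?thesis using assms by (simp add: add_zero)
qed

text \<open>
  The two commutation axioms are self-distributivity of \<open>B\<close> at two zeros and one arbitrary point,
  as zeros act on zeros by \<open>zero_ract\<close>. For the additivity axiom, a point acts on the zero over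
  \<open>x\<^sup>y\<close>, which is the zero over \<open>x\<close> acted on by the zero over \<open>y\<close>; distributing and applying
  \<open>ract_split\<close> produces the two summands.
\<close>
lemma rack_module_fibre_module: "rack_module X fibre_module"
proof (intro rack_module.intro rack_module_axioms.intro)
  interpret R: rack "fst B" using total_obj by (simp add: Obj_Over)
  note objD = Over_objD[OF total_obj]
  show "rack X" by (rule rack_axioms)
  show "comm_group (fib fibre_module x)" if "x \<in> carrier X" for x
    using fibre_comm_group[OF that] by simp
  show "phi fibre_module x y \<in> iso (fib fibre_module x) (fib fibre_module (ract X x y))"
    if x: "x \<in> carrier X" and y: "y \<in> carrier X" for x y
  proof -
    note zy = zero_point[OF y]
    have "(\<lambda>a. ract (fst B) a (zero y)) \<in> hom (fibre x) (fibre (ract X x y))"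
    proof (rule homI)
      fix a b assume "a \<in> carrier (fibre x)" "b \<in> carrier (fibre x)"
      then show "ract (fst B) (a \<otimes>\<^bsub>fibre x\<^esub> b) (zero y) =
          ract (fst B) a (zero y) \<otimes>\<^bsub>fibre (ract X x y)\<^esub> ract (fst B) b (zero y)"
        using add_ract[of a b "zero y" "zero y"] add_zero(1)[OF zy(1)] zy
        by (simp add: carrier_fibre mult_fibre)
    qed (use zy objD in \<open>simp add: carrier_fibre\<close>)
    moreover have "inj_on (\<lambda>a. ract (fst B) a (zero y)) (carrier (fibre x))"
      using R.ract_right_cancel zy by (auto simp: inj_on_def carrier_fibre)
    moreover have "carrier (fibre (ract X x y)) \<subseteq> (\<lambda>a. ract (fst B) a (zero y)) ` carrier (fibre x)"
    proof
      fix c assume c: "c \<in> carrier (fibre (ract X x y))"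
      then obtain a where a: "a \<in> pts B" "ract (fst B) a (zero y) = c"
        using ex1_implies_ex[OF R.ract_unique[of c "zero y"]] zy by (auto simp: carrier_fibre)
      have "ract X (snd B a) y = ract X x y"
        using objD(4)[OF a(1) zy(1)] a zy c by (simp add: carrier_fibre)
      then have "snd B a = x"
        using ract_right_cancel objD(2)[OF a(1)] x y by blast
      then show "c \<in> (\<lambda>a. ract (fst B) a (zero y)) ` carrier (fibre x)"
        using a by (auto simp: carrier_fibre)
    qed
    ultimately show ?thesis
      by (auto simp: iso_def bij_betw_def hom_def Pi_def fibre_module_def)
  qed
  show "psi fibre_module y x \<in> hom (fib fibre_module y) (fib fibre_module (ract X x y))"
    if x: "x \<in> carrier X" and y: "y \<in> carrier X" for x y
  proof (rule homI)
    note zx = zero_point[OF x]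
    show "psi fibre_module y x a \<in> carrier (fib fibre_module (ract X x y))"
      if "a \<in> carrier (fib fibre_module y)" for a
      using that zx objD by (simp add: carrier_fibre)
    show "psi fibre_module y x (a \<otimes>\<^bsub>fib fibre_module y\<^esub> b) = psi fibre_module y x a
        \<otimes>\<^bsub>fib fibre_module (ract X x y)\<^esub> psi fibre_module y x b"
      if "a \<in> carrier (fib fibre_module y)" "b \<in> carrier (fib fibre_module y)" for a b
      using that add_ract[of "zero x" "zero x" a b] add_zero(1)[OF zx(1)] zx
      by (simp add: carrier_fibre mult_fibre)
  qed
  fix x y z assume x: "x \<in> carrier X" and y: "y \<in> carrier X" and z: "z \<in> carrier X"
  note zx = zero_point[OF x] and zy = zero_point[OF y] and zz = zero_point[OF z]
  show "phi fibre_module (ract X x y) z (phi fibre_module x y a) =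
      phi fibre_module (ract X x z) (ract X y z) (phi fibre_module x z a)"
    if "a \<in> carrier (fib fibre_module x)" for a
    using that R.ract_distrib[of a "zero y" "zero z"] zero_ract[OF y z] zy zz
    by (simp add: carrier_fibre)
  show "phi fibre_module (ract X x y) z (psi fibre_module y x a) =
      psi fibre_module (ract X y z) (ract X x z) (phi fibre_module y z a)"
    if "a \<in> carrier (fib fibre_module y)" for a
    using that R.ract_distrib[of "zero x" a "zero z"] zero_ract[OF x z] zx zz
    by (simp add: carrier_fibre)
  show "psi fibre_module z (ract X x y) a =
      phi fibre_module (ract X x z) (ract X y z) (psi fibre_module z x a)
        \<otimes>\<^bsub>fib fibre_module (ract X (ract X x y) z)\<^esub>
      psi fibre_module (ract X y z) (ract X x z) (psi fibre_module z y a)"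
    if "a \<in> carrier (fib fibre_module z)" for a
  proof -
    have a: "a \<in> pts B" "snd B a = z" using that by (simp_all add: carrier_fibre)
    have "ract (fst B) (zero (ract X x y)) a =
        ract (fst B) (ract (fst B) (zero x) a) (ract (fst B) (zero y) a)"
      using R.ract_distrib[OF zx(1) zy(1) a(1)] zero_ract[OF x y] by simp
    also have "\<dots> = add (ract (fst B) (ract (fst B) (zero x) a) (zero (ract X y z)))
        (ract (fst B) (zero (ract X x z)) (ract (fst B) (zero y) a))"
      using ract_split[of "ract (fst B) (zero x) a" "ract (fst B) (zero y) a"] zx zy a objD by simp
    finally show ?thesis by (simp add: mult_fibre)
  qed
qed

end

context rack_in_infinite_universe
begin

lemma bij_group_object_hom_is_iso:
  assumes G: "is_ab_group_object Over G" and H: "is_ab_group_object Over H"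
    and h: "is_group_object_hom Over G H h"
    and bij: "bij_betw h (pts (gobj G)) (pts (gobj H))"
  shows "is_iso (Ab Over) G H h"
proof -
  interpret G: fibrewise_ab_group X "gobj G" "gadd G" "gzero G"
    by (rule fibrewise_ab_group_of_group_object[OF G])
  interpret H: fibrewise_ab_group X "gobj H" "gadd H" "gzero H"
    by (rule fibrewise_ab_group_of_group_object[OF H])
  define g where "g = restrict (inv_into (pts (gobj G)) h) (pts (gobj H))"
  note hom = h[unfolded is_group_object_hom_iff[OF G H], THEN conjunct1]
    and add = h[unfolded is_group_object_hom_iff[OF G H], THEN conjunct2, rule_format]
  note hD = Over_homD[OF hom G.total_obj]
  have g: "g b \<in> pts (gobj G)" "h (g b) = b" "snd (gobj G) (g b) = snd (gobj H) b"
    if "b \<in> pts (gobj H)" for b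
  proof -
    show 1: "g b \<in> pts (gobj G)" "h (g b) = b"
      using bij that by (auto simp: g_def bij_betw_def inv_into_into f_inv_into_f)
    show "snd (gobj G) (g b) = snd (gobj H) b"
      using hD(3)[OF 1(1)] 1(2) by simp
  qed
  have gh: "g (h a) = a" if "a \<in> pts (gobj G)" for a
    using bij that by (auto simp: g_def bij_betw_def)
  have "g \<in> Hom Over (gobj H) (gobj G)"
  proof (rule Over_homI[OF H.total_obj])
    fix b c assume b: "b \<in> pts (gobj H)" and c: "c \<in> pts (gobj H)"
    have "g (ract (fst (gobj H)) b c) = g (h (ract (fst (gobj G)) (g b) (g c)))"
      using hD(4)[OF g(1)[OF b] g(1)[OF c]] g(2)[OF b] g(2)[OF c] by simp
    then show "g (ract (fst (gobj H)) b c) = ract (fst (gobj G)) (g b) (g c)"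
      using gh Over_objD(3)[OF G.total_obj g(1)[OF b] g(1)[OF c]] by simp
  qed (use g in \<open>simp_all add: g_def\<close>)
  moreover have "g (gadd H b c) = gadd G (g b) (g c)"
    if b: "b \<in> pts (gobj H)" and c: "c \<in> pts (gobj H)" and "snd (gobj H) b = snd (gobj H) c" for b c
  proof -
    have "g (gadd H b c) = g (h (gadd G (g b) (g c)))"
      using add[OF g(1)[OF b] g(1)[OF c]] g(2,3)[OF b] g(2,3)[OF c] that(3) by simp
    then show ?thesis
      using gh G.add_point(1)[OF g(1)[OF b] g(1)[OF c]] g(3)[OF b] g(3)[OF c] that(3) by simp
  qed
  ultimately have "is_group_object_hom Over H G g"
    unfolding is_group_object_hom_iff[OF H G] by blast
  moreover have "compose (pts (gobj G)) g h = (\<lambda>a\<in>pts (gobj G). a)"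
    "compose (pts (gobj H)) h g = (\<lambda>b\<in>pts (gobj H). b)"
    unfolding compose_eq_restrict_iff using g gh by auto
  ultimately show ?thesis
    using h by (auto simp: is_iso_def Ab_def Comp_Over Ident_Over)
qed

text \<open>
  The isomorphism forgets the first coordinate, which is recovered as the image in \<open>X\<close>. By
  \<open>ract_split\<close> it respects the operation.
\<close>
lemma total_object_ess_surj:
  assumes G: "is_ab_group_object Over G"
  shows "\<exists>A h. rack_module X A \<and> is_iso (Ab Over) (total_object A) G h"
proof -
  define B where "B = gobj G"
  interpret G: fibrewise_ab_group X B "gadd G" "gzero G"
    unfolding B_def by (rule fibrewise_ab_group_of_group_object[OF G])
  let ?M = G.fibre_module
  note objD = Over_objD[OF G.total_obj]
  have M: "rack_module X ?M" by (rule G.rack_module_fibre_module)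
  define h where "h = (\<lambda>u\<in>pts (total ?M). snd (decode u))"
  have h: "h (encode (x, a)) = a" if "x \<in> carrier X" "a \<in> carrier (fib ?M x)" for x a
    using that by (simp add: h_def)
  have "h \<in> Hom Over (total ?M) B"
  proof (rule Over_homI[OF total_obj[OF M]])
    interpret R: rack "fst (total ?M)" by (rule rack_total[OF M])
    show "h \<in> extensional (pts (total ?M))" by (simp add: h_def)
    fix u assume u: "u \<in> pts (total ?M)"
    then obtain x a where x: "x \<in> carrier X" "a \<in> pts B" "snd B a = x" "u = encode (x, a)"
      by (auto simp: G.carrier_fibre elim!: total_ptsE)
    then show "h u \<in> pts B" "snd B (h u) = snd (total ?M) u"
      by (simp_all add: h G.carrier_fibre)
    fix v assume v: "v \<in> pts (total ?M)"
    then obtain y b where y: "y \<in> carrier X" "b \<in> pts B" "snd B b = y" "v = encode (y, b)"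
      by (auto simp: G.carrier_fibre elim!: total_ptsE)
    have "h (ract (fst (total ?M)) u v) =
        gadd G (ract (fst B) a (gzero G y)) (ract (fst B) (gzero G x) b)"
      using R.ract_closed[OF u v] x y by (simp add: h_def G.mult_fibre)
    also have "\<dots> = ract (fst B) a b"
      using G.ract_split[OF x(2) y(2)] x y by simp
    finally show "h (ract (fst (total ?M)) u v) = ract (fst B) (h u) (h v)"
      using x y by (simp add: h G.carrier_fibre)
  qed
  moreover have "h (encode (x, a \<otimes>\<^bsub>fib ?M x\<^esub> b)) = gadd G (h (encode (x, a))) (h (encode (x, b)))"
    if x: "x \<in> carrier X" and a: "a \<in> carrier (fib ?M x)" and b: "b \<in> carrier (fib ?M x)" for x a b
  proof -
    interpret comm_group "fib ?M x" using G.fibre_comm_group[OF x] by simp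
    have "a \<otimes>\<^bsub>fib ?M x\<^esub> b = gadd G a b" by (simp add: G.mult_fibre)
    then show ?thesis
      using h[OF x m_closed[OF a b]] h[OF x a] h[OF x b] by simp
  qed
  ultimately have hom: "is_group_object_hom Over (total_object ?M) G h"
    unfolding total_object_hom_iff[OF M G] B_def[symmetric] by blast
  have "bij_betw h (pts (total ?M)) (pts B)"
  proof (rule bij_betw_byWitness[of _ "\<lambda>b. encode (snd B b, b)"])
    show "\<forall>u\<in>pts (total ?M). encode (snd B (h u), h u) = u"
      by (auto simp: h G.carrier_fibre elim!: total_ptsE)
    show "\<forall>b\<in>pts B. h (encode (snd B b, b)) = b"
      using objD(2) by (simp add: h G.carrier_fibre)
    show "h ` pts (total ?M) \<subseteq> pts B"
      by (auto simp: h G.carrier_fibre elim!: total_ptsE)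
    show "(\<lambda>b. encode (snd B b, b)) ` pts B \<subseteq> pts (total ?M)"
      using objD(2) by (auto simp: G.carrier_fibre)
  qed
  then have "is_iso (Ab Over) (total_object ?M) G h"
    using bij_group_object_hom_is_iso[OF total_object_ab[OF M] G hom]
    unfolding gobj_total_object[OF M] B_def[symmetric] by blast
  with M show ?thesis by blast
qed

end

section \<open>Modules and Abelian group objects are equivalent\<close>

theorem theorem2p2:
  fixes X :: "'u rack"
  assumes "infinite (UNIV :: 'u set)"
    and "rack X"
  shows "equivalent_categories (RMod X) (Ab (slice_category Rack X))"
proof -
  interpret rack_in_infinite_universe X
    by (intro rack_in_infinite_universe.intro rack_in_infinite_universe_axioms.intro assms)
  show ?thesis
  proof (rule equivalent_categories_if_fully_faithful_ess_surj
      [OF category_RMod[OF assms(2)] category_Ab is_functor_total])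
    fix A B f g
    assume "f \<in> Hom (RMod X) A B" "g \<in> Hom (RMod X) A B"
      "arr_map \<lparr>obj_map = total_object, arr_map = \<lambda>A B. total_map A\<rparr> A B f =
       arr_map \<lparr>obj_map = total_object, arr_map = \<lambda>A B. total_map A\<rparr> A B g"
    then show "f = g"
      using total_map_faithful[of f A B g] by (simp add: RMod_def)
  next
    fix A B h
    assume "A \<in> Obj (RMod X)" "B \<in> Obj (RMod X)"
      "h \<in> Hom (Ab Over) (obj_map \<lparr>obj_map = total_object, arr_map = \<lambda>A B. total_map A\<rparr> A)
        (obj_map \<lparr>obj_map = total_object, arr_map = \<lambda>A B. total_map A\<rparr> B)"
    then show "\<exists>f\<in>Hom (RMod X) A B.
        arr_map \<lparr>obj_map = total_object, arr_map = \<lambda>A B. total_map A\<rparr> A B f = h"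
      using total_map_full[of A B h] by (simp add: RMod_def Ab_def)
  next
    fix G assume "G \<in> Obj (Ab Over)"
    then show "\<exists>A\<in>Obj (RMod X). \<exists>h.
        is_iso (Ab Over) (obj_map \<lparr>obj_map = total_object, arr_map = \<lambda>A B. total_map A\<rparr> A) G h"
      using total_object_ess_surj[of G] by (simp add: RMod_def Ab_def)
  qed
qed

end
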